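(* (Local Conditioning Sum-Product Belief Propagation.) Let $G=(V,E)$ be a finite undirected network with a Gibbs distribution given by positive self potentials $\Phi_i$ ($i\in V$) and positive edge potentials $\Psi_{ij}$ ($\{i,j\}\in E$) over a finite alphabet $\mathcal X$. Let $L\subset V$ be a loop cutset, and let $T$ be an associated tree for $L$ dictating the conditioned message passing. With the relevant sets $R_{ij}$, $R_i$, the sets $\mathcal L_l$, $\mathcal N_l$, $L_{j\setminus i}$, the split self potentials, and the conditioned beliefs and messages as described in the context, the following hold. **(1) Non loop cutset nodes.** For a non loop cutset node $j\notin L$, local conditioned beliefs and messages (to a neighbor $i\in\partial j$) are computed as $$Z_j^{(\mathbf x_{R_j})}=\Phi_j\prod_{k\in\partial j} m_{k\to j}^{(\mathbf x_{R_{kj}})}$$ and $$m_{j\to i}^{(\mathbf x_{R_{ji}})}=\Psi_{ji}\,\Phi_j\sum_{\mathbf x_{L^{j\setminus i}}}\ \prod_{k\in\partial j\setminus i} m_{k\to j}^{(\mathbf x_{R_{jk}})},$$ where $$L^{j\setminus i}:=\Big(\bigcup_{k\in\partial j\setminus i}R_{kj}\Big)\setminus R_{ij}$$ is the set of loop cutset nodes all of whose copies are upstream of the message from $j$ to $i$ but are not in any of the $L_{k\setminus j}$ for $k\in\partial j\setminus i$. Unconditioned beliefs are computed as $$Z_j=\sum_{\mathbf x_{R_j}}Z_j^{(\mathbf x_{R_j})}.$$ **(2) Loop cutset nodes.** For a loop cutset node $l\in L$, conditioned beliefs are computed as $$Z_l^{(\mathbf x_{R_l})}=\Phi_{l^j}^{(x_l)}\,m_{j\to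 l}^{(\mathbf x_{R_{jl}})}\quad\text{for some } j\in\mathcal L_l,$$ or as $$Z_l^{(\mathbf x_{R_l})}=\Phi_{l^{\mathcal N_l}}^{(x_l)}\prod_{j\in\mathcal N_l}m_{j\to l}^{(\mathbf x_{R_{jl}})}.$$ The message to a neighbor $i\in\mathcal N_l$ is computed as $$m_{l\to i}^{(\mathbf x_{R_{li}})}=\Psi_{li}\,\Phi_{l^{\mathcal N_l}}^{(x_l)}\sum_{\mathbf x_{L^{l\setminus i}}}\ \prod_{k\in\mathcal N_l\setminus i}m_{k\to l}^{(\mathbf x_{R_{kl}})},$$ where $$L^{l\setminus i}:=\Big(\bigcup_{k\in\partial l\setminus i}R_{kl}\Big)\setminus R_{il}$$ is the set of loop cutset nodes all of whose copies are upstream of the message from $l$ to $i$ but are not in any of the $L_{k\setminus l}$ for $k\in\partial l\setminus i$. Unconditioned beliefs are computed as $$Z_l=\sum_{\mathbf x_{R_l}}Z_l^{(\mathbf x_{R_l})}.$$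
   Context: **Gibbs model and beliefs.** $\partial i$ is the set of neighbors of $i$ in $G$; $\partial j\setminus i$ is the set of neighbors of $j$ other than $i$. For $S\subset V$, $\mathbf x_S$ is a configuration on $S$, i.e. an assignment of a value in $\mathcal X$ to each node of $S$. The self potential $\Phi_i=[\Phi_i(x_i)]$ is a positive vector and the edge potential $\Psi_{ij}=[\Psi_{ij}(x_i,x_j)]$ a positive matrix. The belief of node $i$ is the vector $Z_i$ with components $$Z_i(x_i)=\Phi_i(x_i)\sum_{\mathbf x_{V\setminus i}}\ \prod_{\{j,k\}\in E}\Psi_{jk}(x_j,x_k)\prod_{j\ne i}\Phi_j(x_j);$$ normalizing it gives the marginal probabilities of node $i$. For a set $S$ of nodes, $Z_i^{(\mathbf x_S)}$ denotes the belief at $i$ conditioned on the configuration $\mathbf x_S$, so that $Z_i=\sum_{\mathbf x_S}Z_i^{(\mathbf x_S)}$. **Vector conventions.** Products of vectors are element-wise. The edge potential matrix $\Psi_{ji}$ acts by matrix multiplication on the whole vector expression to its right, summing over the values of $j$ and giving a vector indexed by the values of $i$. When messages conditioned on different sets are combined, each is evaluated at the restriction of the common configuration to its own conditioning set (incoming messages are expanded and reordered accordingly). **Loop cutset and associated tree.** A loop cutset is a set $L$ of nodes whose removal eliminates all cycles in the network. To open up $G$ at $L$: for each $l\in L$, remove $l$ and all edges incident to it, and attach a copy of $l$ to each neighbor $j\in\partial l$; then copies of a split node may be re-identified so as to form a connected network that is still acyclic. Such a connected acyclic opening is an associated tree $T$. For $l\in L$, $\mathcal L_l\subset\partial l$ is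 the set of neighbors $j$ for which the copy of $l$ attached to $j$ is a leaf of $T$ (this leaf copy is denoted $l^j$), and $\mathcal N_l=\partial l\setminus\mathcal L_l$ is the set of neighbors connected to a non-leaf copy of $l$ in $T$ (denoted $l^{\mathcal N_l}$). For an edge $\{i,j\}$, $T_{j\setminus i}$ is the component containing $j$ of $T$ with the edge $\{i,j\}$ removed. A node is upstream of the message from $j$ to $i$ if it is in $T_{j\setminus i}$, and downstream of it if it is in $T_{i\setminus j}$. **Self-potential splitting.** For each $l\in L$ exponents $\alpha_j$ ($j\in\mathcal L_l$) and $\alpha_{\mathcal N_l}$ are fixed with $\sum_{j\in\mathcal L_l}\alpha_j+\alpha_{\mathcal N_l}=1$; $\Phi_{l^j}=\Phi_l^{\alpha_j}$ and $\Phi_{l^{\mathcal N_l}}=\Phi_l^{\alpha_{\mathcal N_l}}$ (entrywise powers). Further, $\Phi_{l^j}^{(x_l)}=\Phi_{l^j}\,\delta^{(x_l)}$ and $\Phi_{l^{\mathcal N_l}}^{(x_l)}=\Phi_{l^{\mathcal N_l}}\,\delta^{(x_l)}$, where $\delta^{(x_l)}$ is the indicator vector of the value $x_l$, and $x_l$ is the value of $l$ under the loop cutset configuration. **Relevant sets.** $L_{j\setminus i}\subset L$ is the set of loop cutset nodes all of whose copies are contained in $T_{j\setminus i}$. For an edge $\{i,j\}$, $R_{ij}=R_{ji}=L\setminus(L_{i\setminus j}\cup L_{j\setminus i})$. For a node $i$, $R_i=\bigcup_{j\in\partial i}R_{ij}$. Convention: such definitions and computations are written without reference to whether a node is in the loop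 cutset; if one wishes to consider specifically a loop cutset node $l$, either $\mathcal N_l$, or $\{j\}$ for some $j\in\mathcal L_l$, can be substituted for the neighborhood. **Conditioned messages.** For a loop cutset configuration $\mathbf x_L$, conditioned messages are given recursively by: $m_{i\to j}^{(\mathbf x_L)}=\Psi_{ij}\Phi_i\prod_{k\in\partial i\setminus j}m_{k\to i}^{(\mathbf x_L)}$ for $i\notin L$; $m_{l\to j}^{(\mathbf x_L)}=\Psi_{lj}\Phi_{l^j}^{(x_l)}$ for $l\in L$, $j\in\mathcal L_l$; and $m_{l\to j}^{(\mathbf x_L)}=\Psi_{lj}\Phi_{l^{\mathcal N_l}}^{(x_l)}\prod_{k\in\mathcal N_l\setminus j}m_{k\to l}^{(\mathbf x_L)}$ for $l\in L$, $j\in\mathcal N_l$. **Local conditioned messages.** $L$ is partitioned as $(L_{i\setminus j},R_{ij},L_{j\setminus i})$, and $m_{j\to i}^{(\mathbf x_L)}$ does not depend on $\mathbf x_{L_{i\setminus j}}$, so it is written $m_{j\to i}^{(\mathbf x_{R_{ji}},\,\mathbf x_{L_{j\setminus i}})}$. The local conditioned message is obtained by summing out the upstream loop cutset nodes: $$m_{j\to i}^{(\mathbf x_{R_{ji}})}=\sum_{\mathbf x_{L_{j\setminus i}}}m_{j\to i}^{(\mathbf x_{R_{ji}},\,\mathbf x_{L_{j\setminus i}})}.$$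
   Formalization: In (2) the conditioned formulas are stated for l with at least two copies in T (they fail for one copy, e.g. G a single edge, L={l}), and the factor Φ_{l^{N_l}}^{(x_l)} stands inside the sum over L^{l\i}, since x_l may be summed there; isolated cutset nodes, which have no copy, are excluded. *)

theory Defs
  imports Complex_Main "HOL-Library.FuncSet" "HOL-Library.Disjoint_Sets"
begin

section \<open>Finite undirected simple graphs\<close>

text \<open>A graph is a vertex set together with a set of two-element edges \<open>{u, v}\<close>.\<close>

definition simple_graph :: "'a set \<Rightarrow> 'a set set \<Rightarrow> bool" where
  "simple_graph V E \<longleftrightarrow> finite V \<and> (\<forall>e\<in>E. \<exists>u\<in>V. \<exists>v\<in>V. u \<noteq> v \<and> e = {u, v})"

definition nbrs_in :: "'a set set \<Rightarrow> 'a \<Rightarrow> 'a set" where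
  "nbrs_in E u = {v. {u, v} \<in> E}"

definition component :: "'a set set \<Rightarrow> 'a \<Rightarrow> 'a set" where
  "component E u = {v. (\<lambda>a b. {a, b} \<in> E)\<^sup>*\<^sup>* u v}"

definition connected_graph :: "'a set \<Rightarrow> 'a set set \<Rightarrow> bool" where
  "connected_graph V E \<longleftrightarrow> V \<noteq> {} \<and> (\<forall>u\<in>V. \<forall>v\<in>V. v \<in> component E u)"

definition graph_cycle :: "'a set set \<Rightarrow> 'a list \<Rightarrow> bool" where
  "graph_cycle E p \<longleftrightarrow> 3 \<le> length p \<and> distinct p \<and>
     successively (\<lambda>u v. {u, v} \<in> E) p \<and> {last p, hd p} \<in> E"

definition acyclic_graph :: "'a set set \<Rightarrow> bool" where
  "acyclic_graph E \<longleftrightarrow> \<not> (\<exists>p. graph_cycle E p)"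

section \<open>Gibbs networks and beliefs\<close>

record ('v, 'x) network =
  nodes :: "'v set"
  links :: "'v set set"
  self_pot :: "'v \<Rightarrow> 'x \<Rightarrow> real"
  edge_pot :: "'v \<Rightarrow> 'v \<Rightarrow> 'x \<Rightarrow> 'x \<Rightarrow> real"

text \<open>
  The number \<open>\<Psi>\<^sub>i\<^sub>j(x\<^sub>i, x\<^sub>j)\<close> is \<open>edge_pot N i j x\<^sub>i x\<^sub>j\<close>. Edges are undirected, so the two
  orientations of an edge potential must be transposes of each other.
\<close>

definition gibbs_network :: "('v, 'x, 'm) network_scheme \<Rightarrow> bool" where
  "gibbs_network N \<longleftrightarrow> simple_graph (nodes N) (links N) \<and>
     (\<forall>i\<in>nodes N. \<forall>a. 0 < self_pot N i a) \<and>
     (\<forall>i j a b. {i, j} \<in> links N \<longrightarrow> 0 < edge_pot N i j a b \<and> edge_pot N i j a b = edge_pot N j i b a)"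

abbreviation nbrs :: "('v, 'x, 'm) network_scheme \<Rightarrow> 'v \<Rightarrow> 'v set" where
  "nbrs N \<equiv> nbrs_in (links N)"

definition configs :: "'v set \<Rightarrow> ('v \<Rightarrow> 'x) set" where
  "configs S = S \<rightarrow>\<^sub>E UNIV"

text \<open>The choice of an orientation is immaterial by symmetry of the edge potentials.\<close>

definition edge_weight :: "('v, 'x, 'm) network_scheme \<Rightarrow> 'v set \<Rightarrow> ('v \<Rightarrow> 'x) \<Rightarrow> real" where
  "edge_weight N e z = (let (j, k) = (SOME (j, k). e = {j, k}) in edge_pot N j k (z j) (z k))"

definition belief :: "('v, 'x::finite, 'm) network_scheme \<Rightarrow> 'v \<Rightarrow> 'x \<Rightarrow> real" where
  "belief N i = (\<lambda>a. self_pot N i a *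
     (\<Sum>z\<in>configs (nodes N - {i}).
        (\<Prod>e\<in>links N. edge_weight N e (z(i := a))) * (\<Prod>j\<in>nodes N - {i}. self_pot N j (z j))))"

text \<open>
  The belief conditioned on a configuration \<open>x\<close> of \<open>S\<close>: only the joint configurations that agree
  with \<open>x\<close> on \<open>S\<close> contribute. No normalization takes place.
\<close>

definition cond_belief ::
    "('v, 'x::finite, 'm) network_scheme \<Rightarrow> 'v \<Rightarrow> 'v set \<Rightarrow> ('v \<Rightarrow> 'x) \<Rightarrow> 'x \<Rightarrow> real" where
  "cond_belief N i S x = (\<lambda>a. self_pot N i a *
     (\<Sum>z\<in>{z \<in> configs (nodes N - {i}). \<forall>s\<in>S. (z(i := a)) s = x s}.
        (\<Prod>e\<in>links N. edge_weight N e (z(i := a))) * (\<Prod>j\<in>nodes N - {i}. self_pot N j (z j))))"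

text \<open>The matrix \<open>\<Psi>\<^sub>j\<^sub>i\<close> applied to a vector indexed by the values of \<open>j\<close>.\<close>

definition edge_act ::
    "('v, 'x::finite, 'm) network_scheme \<Rightarrow> 'v \<Rightarrow> 'v \<Rightarrow> ('x \<Rightarrow> real) \<Rightarrow> 'x \<Rightarrow> real" where
  "edge_act N j i f = (\<lambda>b. \<Sum>a\<in>UNIV. edge_pot N j i a b * f a)"

section \<open>Loop cutsets and associated trees\<close>

text \<open>
  Opening up the network at \<open>l\<close> puts one copy of \<open>l\<close> at each neighbor and then identifies some of
  these copies again. The outcome is recorded as a partition \<open>ident N l\<close> of the neighborhood of
  \<open>l\<close>: the copies of \<open>l\<close> are the pairs \<open>(l, B)\<close> with \<open>B\<close> a block, and \<open>(l, B)\<close> is adjacent to (a copy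
  of) each member of \<open>B\<close>. The leaf copy attached to \<open>j\<close> is thus \<open>(l, {j})\<close>, and the copy \<open>(l, B)\<close>
  carries the exponent \<open>expo N l B\<close>. A node \<open>i\<close> outside the cutset has the single copy
  \<open>(i, nbrs N i)\<close>.
\<close>

record ('v, 'x) cut_network = "('v, 'x) network" +
  cutset :: "'v set"
  ident :: "'v \<Rightarrow> 'v set set"
  expo :: "'v \<Rightarrow> 'v set \<Rightarrow> real"

definition loop_cutset :: "('v, 'x) cut_network \<Rightarrow> bool" where
  "loop_cutset N \<longleftrightarrow> cutset N \<subseteq> nodes N \<and> acyclic_graph {e \<in> links N. e \<inter> cutset N = {}}"

definition blocks :: "('v, 'x) cut_network \<Rightarrow> 'v \<Rightarrow> 'v set set" where
  "blocks N i = (if i \<in> cutset N then ident N i else {nbrs N i})"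

definition tree_nodes :: "('v, 'x) cut_network \<Rightarrow> ('v \<times> 'v set) set" where
  "tree_nodes N = (SIGMA i:nodes N. blocks N i)"

text \<open>The copy of \<open>i\<close> adjacent to a copy of \<open>j\<close>, for an edge \<open>{i, j}\<close>.\<close>

definition copy_at :: "('v, 'x) cut_network \<Rightarrow> 'v \<Rightarrow> 'v \<Rightarrow> 'v \<times> 'v set" where
  "copy_at N i j = (i, THE B. B \<in> blocks N i \<and> j \<in> B)"

definition tree_links :: "('v, 'x) cut_network \<Rightarrow> ('v \<times> 'v set) set set" where
  "tree_links N = {{copy_at N i j, copy_at N j i} | i j. {i, j} \<in> links N}"

text \<open>The set \<open>\<L>\<^sub>l\<close>; being a leaf means having degree one in the opened network.\<close>

definition leaf_nbrs :: "('v, 'x) cut_network \<Rightarrow> 'v \<Rightarrow> 'v set" where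
  "leaf_nbrs N l = {j \<in> nbrs N l. card (nbrs_in (tree_links N) (copy_at N l j)) = 1}"

definition inner_nbrs :: "('v, 'x) cut_network \<Rightarrow> 'v \<Rightarrow> 'v set" where
  "inner_nbrs N l = nbrs N l - leaf_nbrs N l"

text \<open>
  The last conjunct says that all of \<open>\<N>\<^sub>l\<close> is attached to one and the same non-leaf copy of \<open>l\<close>,
  as the notation for that copy presupposes.
\<close>

definition associated_tree :: "('v, 'x) cut_network \<Rightarrow> bool" where
  "associated_tree N \<longleftrightarrow>
     (\<forall>l\<in>cutset N. partition_on (nbrs N l) (ident N l)) \<and>
     connected_graph (tree_nodes N) (tree_links N) \<and>
     acyclic_graph (tree_links N) \<and>
     (\<forall>l\<in>cutset N. inner_nbrs N l \<noteq> {} \<longrightarrow> inner_nbrs N l \<in> ident N l)"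

text \<open>
  An \<open>l\<close> whose copies have all been identified again is not split. It then belongs to no
  relevant set, so that a message or belief conditioned on relevant sets at \<open>l\<close> does not involve
  \<open>x\<^sub>l\<close> at all.
\<close>

definition is_split :: "('v, 'x) cut_network \<Rightarrow> 'v \<Rightarrow> bool" where
  "is_split N l \<longleftrightarrow> 2 \<le> card (ident N l)"

text \<open>
  With \<open>\<alpha>\<^sub>j = expo N l {j}\<close> for leaf copies, and \<open>expo N l (inner_nbrs N l)\<close> for the non-leaf copy
  if there is one.
\<close>

definition potential_splitting :: "('v, 'x) cut_network \<Rightarrow> bool" where
  "potential_splitting N \<longleftrightarrow> (\<forall>l\<in>cutset N. (\<Sum>B\<in>ident N l. expo N l B) = 1)"

text \<open>The self potential of the copy \<open>(l, B)\<close>, clamped to the value \<open>c\<close> of \<open>l\<close>.\<close>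

definition clamped_pot :: "('v, 'x) cut_network \<Rightarrow> 'v \<Rightarrow> 'v set \<Rightarrow> 'x \<Rightarrow> 'x \<Rightarrow> real" where
  "clamped_pot N l B c = (\<lambda>a. (self_pot N l a powr expo N l B) * (if a = c then 1 else 0))"

section \<open>Relevant sets\<close>

text \<open>\<open>subtree N j i\<close> is \<open>T\<^sub>j\<^sub>\<setminus>\<^sub>i\<close> and \<open>upstream N j i\<close> is \<open>L\<^sub>j\<^sub>\<setminus>\<^sub>i\<close>.\<close>

definition subtree :: "('v, 'x) cut_network \<Rightarrow> 'v \<Rightarrow> 'v \<Rightarrow> ('v \<times> 'v set) set" where
  "subtree N j i = component (tree_links N - {{copy_at N i j, copy_at N j i}}) (copy_at N j i)"

definition upstream :: "('v, 'x) cut_network \<Rightarrow> 'v \<Rightarrow> 'v \<Rightarrow> 'v set" where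
  "upstream N j i = {l \<in> cutset N. \<forall>B\<in>ident N l. (l, B) \<in> subtree N j i}"

definition rel_edge :: "('v, 'x) cut_network \<Rightarrow> 'v \<Rightarrow> 'v \<Rightarrow> 'v set" where
  "rel_edge N i j = cutset N - (upstream N i j \<union> upstream N j i)"

text \<open>
  \<open>R\<^sub>i\<close> and \<open>L\<^sup>j\<^sup>\<setminus>\<^sup>i\<close> take the neighborhood \<open>S\<close> of the node as a parameter. It is the full neighborhood,
  except that at a cutset node \<open>l\<close> one may substitute \<open>\<N>\<^sub>l\<close>, or \<open>{j}\<close> with \<open>j \<in> \<L>\<^sub>l\<close>, for it.
\<close>

definition rel_node :: "('v, 'x) cut_network \<Rightarrow> 'v \<Rightarrow> 'v set \<Rightarrow> 'v set" where
  "rel_node N i S = (\<Union>j\<in>S. rel_edge N i j)"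

definition sum_set :: "('v, 'x) cut_network \<Rightarrow> 'v set \<Rightarrow> 'v \<Rightarrow> 'v \<Rightarrow> 'v set" where
  "sum_set N S j i = (\<Union>k\<in>S - {i}. rel_edge N k j) - rel_edge N i j"

section \<open>Conditioned messages\<close>

text \<open>
  \<open>cond_msg N x i j\<close> is the message from \<open>i\<close> to \<open>j\<close> under the cutset configuration \<open>x\<close>. The
  recursion runs over the edges of the opened network directed away from the receiver, so it
  terminates when that network is a finite tree; it need not terminate otherwise.
\<close>

function (domintros) cond_msg ::
    "('v, 'x::finite) cut_network \<Rightarrow> ('v \<Rightarrow> 'x) \<Rightarrow> 'v \<Rightarrow> 'v \<Rightarrow> 'x \<Rightarrow> real" where
  "cond_msg N x i j =
    (if i \<notin> cutset N then
       edge_act N i j (\<lambda>a. self_pot N i a * (\<Prod>k\<in>nbrs N i - {j}. cond_msg N x k i a))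
     else if j \<in> leaf_nbrs N i then
       edge_act N i j (clamped_pot N i {j} (x i))
     else
       edge_act N i j (\<lambda>a. clamped_pot N i (inner_nbrs N i) (x i) a *
         (\<Prod>k\<in>inner_nbrs N i - {j}. cond_msg N x k i a)))"
  by pat_completeness auto

text \<open>
  The local message from \<open>j\<close> to \<open>i\<close> given a configuration \<open>x\<close> of \<open>rel_edge N j i\<close>. The cutset
  nodes in \<open>upstream N i j\<close> keep whatever value \<open>x\<close> has there: the message does not depend on it.
\<close>

definition local_msg ::
    "('v, 'x::finite) cut_network \<Rightarrow> 'v \<Rightarrow> 'v \<Rightarrow> ('v \<Rightarrow> 'x) \<Rightarrow> 'x \<Rightarrow> real" where
  "local_msg N j i x = (\<lambda>a. \<Sum>y\<in>configs (upstream N j i).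
     cond_msg N (override_on x y (upstream N j i)) j i a)"

end

(*
  Seen from a copy (i, B) of i, the associated tree is that copy together with the disjoint branches
  hanging off the members k of B, and the part of the tree behind i, away from j in B, is the copy
  together with the branches at the other members of B. A loop cutset node fails to be relevant
  around the copy exactly when all its copies lie in a single branch, so the irrelevant cutset nodes
  split into the disjoint sets upstream of the incoming messages, and each incoming message depends
  only on the cutset nodes with a copy in its own branch. Sums over upstream nodes therefore
  distribute over products of messages; this gives the message rule directly from the recursion.
  For the beliefs, induction along the tree identifies a conditioned message with the sum over the
  non-cutset nodes in its branch of the Gibbs weight of the branch, and the weight of the network is
  the product of the weights of the branches and of the potential of the copy they hang off.
*)
theory Submission
  imports Defs
begin

subsection \<open>Edges of a tree\<close>

text \<open>A walk is extended edge by edge; whenever the next vertex already lies on the path found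
  so far, the path is cut back to that vertex.\<close>

lemma distinct_path:
  assumes "r\<^sup>*\<^sup>* a b"
  obtains p where "p \<noteq> []" "hd p = a" "last p = b" "distinct p" "successively r p"
proof -
  from assms have "\<exists>p. p \<noteq> [] \<and> hd p = a \<and> last p = b \<and> distinct p \<and> successively r p"
  proof induction
    case base
    show ?case by (intro exI[of _ "[a]"]) simp
  next
    case (step y z)
    then obtain p where p: "p \<noteq> []" "hd p = a" "last p = y" "distinct p" "successively r p"
      by blast
    show ?case
    proof (cases "z \<in> set p")
      case True
      then obtain us vs where "p = us @ z # vs" by (meson split_list)
      with p show ?thesis
        by (intro exI[of _ "us @ [z]"]) (auto simp: successively_append_iff hd_append)
    next
      case False
      with p step.hyps show ?thesis
        by (intro exI[of _ "p @ [z]"]) (auto simp: successively_append_iff hd_append)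
    qed
  qed
  with that show thesis by blast
qed

text \<open>A path from \<open>a\<close> to \<open>b\<close> that avoids the edge
  \<open>{a, b}\<close> would close up with this edge to a cycle.\<close>

lemma acyclic_bridge:
  assumes "acyclic_graph E" "{a, b} \<in> E" "a \<noteq> b"
  shows "b \<notin> component (E - {{a, b}}) a"
proof
  assume "b \<in> component (E - {{a, b}}) a"
  then obtain p where p: "p \<noteq> []" "hd p = a" "last p = b" "distinct p"
      "successively (\<lambda>u v. {u, v} \<in> E - {{a, b}}) p"
    unfolding component_def by (auto elim: distinct_path)
  obtain q where q: "p = a # q" using p by (cases p) auto
  then obtain c q' where q': "q = c # q'" using p \<open>a \<noteq> b\<close> by (cases q) auto
  \<comment> \<open>A path of only two vertices would be the removed edge itself.\<close>
  have "q' \<noteq> []" using p q q' by auto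
  hence "3 \<le> length p" using q q' by (cases q') auto
  moreover have "successively (\<lambda>u v. {u, v} \<in> E) p"
    by (rule successively_mono[OF p(5)]) auto
  ultimately have "graph_cycle E p"
    using p assms by (auto simp: graph_cycle_def insert_commute)
  with assms show False by (auto simp: acyclic_graph_def)
qed

text \<open>The part of a tree behind \<open>a\<close>, as seen from its neighbour \<open>b\<close>.
  It is set up for arbitrary edge sets; \<open>subtree\<close> is its instance for the opened
  network.\<close>

definition side :: "'a set set \<Rightarrow> 'a \<Rightarrow> 'a \<Rightarrow> 'a set" where
  "side E a b = component (E - {{a, b}}) a"

lemma side_self: "a \<in> side E a b"
  by (simp add: side_def component_def)

lemma side_step: "u \<in> side E a b \<Longrightarrow> {u, v} \<in> E \<Longrightarrow> {u, v} \<noteq> {a, b} \<Longrightarrow> v \<in> side E a b"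
  by (auto simp: side_def component_def intro: rtranclp.rtrancl_into_rtrancl)

lemma side_induct [consumes 1, case_names base step]:
  assumes "u \<in> side E a b" "P a"
    and "\<And>u v. u \<in> side E a b \<Longrightarrow> P u \<Longrightarrow> {u, v} \<in> E \<Longrightarrow> {u, v} \<noteq> {a, b} \<Longrightarrow> P v"
  shows "P u"
proof -
  from assms(1) have "(\<lambda>u v. {u, v} \<in> E - {{a, b}})\<^sup>*\<^sup>* a u"
    by (simp add: side_def component_def)
  thus ?thesis
  proof induction
    case base
    show ?case by (rule assms(2))
  next
    case (step y z)
    thus ?case using assms(3)[of y z] by (simp add: side_def component_def)
  qed
qed

lemma side_notin:
  assumes "acyclic_graph E" "{a, b} \<in> E" "a \<noteq> b"
  shows "b \<notin> side E a b"
  using acyclic_bridge[OF assms] by (simp add: side_def)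

lemma side_edge:
  assumes "acyclic_graph E" "{a, b} \<in> E" "a \<noteq> b" "u \<in> side E a b" "{u, v} \<in> E"
  shows "v \<in> side E a b \<or> u = a \<and> v = b"
  using side_step[OF assms(4,5)] side_notin[OF assms(1-3)] assms(4) by (auto simp: doubleton_eq_iff)

text \<open>A walk from \<open>a\<close> that avoids \<open>{a, b}\<close> and meets the side of
  \<open>b\<close> could be traced backwards, which would put \<open>a\<close> itself on the side of
  \<open>b\<close>.\<close>

lemma side_disjoint:
  assumes "acyclic_graph E" "{a, b} \<in> E" "a \<noteq> b"
  shows "side E a b \<inter> side E b a = {}"
proof -
  have "u \<notin> side E b a" if "u \<in> side E a b" for u
    using that
  proof (induction rule: side_induct)
    case base
    show ?case using side_notin[of E b a] assms by (simp add: insert_commute)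
  next
    case (step u v)
    show ?case
    proof
      assume "v \<in> side E b a"
      hence "u \<in> side E b a"
        by (rule side_step) (use step in \<open>auto simp: insert_commute\<close>)
      with step show False by blast
    qed
  qed
  thus ?thesis by blast
qed

text \<open>Walks from \<open>q\<close> that avoid \<open>{q, p}\<close> never reach
  \<open>p\<close>, so they never use the edge \<open>{p, q'}\<close> either, and \<open>q\<close>
  itself is one allowed step away from \<open>p\<close>.\<close>

lemma side_subset:
  assumes "acyclic_graph E" "{q, p} \<in> E" "q \<noteq> p" "q \<noteq> q'"
  shows "side E q p \<subseteq> side E p q'"
proof
  fix u assume "u \<in> side E q p"
  thus "u \<in> side E p q'"
  proof (induction rule: side_induct)
    case base
    show ?case
      by (rule side_step[OF side_self]) (use assms in \<open>auto simp: insert_commute doubleton_eq_iff\<close>)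
  next
    case (step u v)
    have "p \<notin> side E q p" using assms by (intro side_notin)
    moreover have "v \<in> side E q p" using step by (blast intro: side_step)
    ultimately have "{u, v} \<noteq> {p, q'}" using step by (auto simp: doubleton_eq_iff)
    with step show ?case by (blast intro: side_step)
  qed
qed

text \<open>Along a walk from \<open>p\<close>, each vertex other than \<open>p\<close> lies on the
  side of the neighbour through which \<open>p\<close> was last left, because a side can be left
  only through \<open>p\<close>. The last assumption excludes loops, which
  \<open>acyclic_graph\<close> permits.\<close>

lemma component_cover:
  assumes "acyclic_graph E" "u \<in> component E p" "\<And>q. {q, p} \<in> E \<Longrightarrow> q \<noteq> p"
  shows "u = p \<or> (\<exists>q. {q, p} \<in> E \<and> u \<in> side E q p)"
proof -
  from assms(2) have "(\<lambda>a b. {a, b} \<in> E)\<^sup>*\<^sup>* p u" by (simp add: component_def)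
  thus ?thesis
  proof induction
    case (step u v)
    show ?case
    proof (cases "u = p")
      case True
      with step show ?thesis using side_self by (metis insert_commute)
    next
      case False
      then obtain q where "{q, p} \<in> E" "u \<in> side E q p" using step by blast
      with side_edge[OF assms(1) _ _ _ step(2)] assms(3) show ?thesis by blast
    qed
  qed simp
qed

subsection \<open>Partial summation over configurations\<close>

text \<open>The result is again a function of a total configuration whose values on \<open>S\<close>
  are overwritten, so that partial sums can be iterated. Local messages and conditioned beliefs both
  become sums of this kind.\<close>

definition marg :: "'v set \<Rightarrow> (('v \<Rightarrow> 'x) \<Rightarrow> real) \<Rightarrow> ('v \<Rightarrow> 'x) \<Rightarrow> real" where
  "marg S g x = (\<Sum>z\<in>configs S. g (override_on x z S))"

definition depends_on :: "(('v \<Rightarrow> 'x) \<Rightarrow> 'b) \<Rightarrow> 'v set \<Rightarrow> bool" where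
  "depends_on g S \<longleftrightarrow> (\<forall>x y. (\<forall>v\<in>S. x v = y v) \<longrightarrow> g x = g y)"

lemma depends_onD: "depends_on g S \<Longrightarrow> (\<And>v. v \<in> S \<Longrightarrow> x v = y v) \<Longrightarrow> g x = g y"
  by (auto simp: depends_on_def)

lemma depends_on_mono: "depends_on g S \<Longrightarrow> S \<subseteq> S' \<Longrightarrow> depends_on g S'"
  unfolding depends_on_def by blast

lemma depends_on_prod:
  fixes g :: "'k \<Rightarrow> ('v \<Rightarrow> 'x) \<Rightarrow> real"
  assumes "\<And>k. k \<in> K \<Longrightarrow> depends_on (g k) (S k)"
  shows "depends_on (\<lambda>w. \<Prod>k\<in>K. g k w) (\<Union>k\<in>K. S k)"
  unfolding depends_on_def
proof (intro allI impI prod.cong refl)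
  fix x y :: "'v \<Rightarrow> 'x" and k
  assume "\<forall>v\<in>(\<Union>k\<in>K. S k). x v = y v" "k \<in> K"
  thus "g k x = g k y" using assms[of k] by (intro depends_onD[of "g k" "S k"]) auto
qed

lemma marg_empty [simp]: "marg {} g x = g x"
  by (simp add: marg_def configs_def)

lemma marg_insert:
  fixes x :: "'v \<Rightarrow> 'x::finite"
  assumes "i \<notin> S"
  shows "marg (insert i S) g x = (\<Sum>a\<in>UNIV. marg S g (x(i := a)))"
proof -
  \<comment> \<open>Since \<open>i\<close> is not in \<open>S\<close>, its value may be set in the
    parameter \<open>x\<close> instead of in the summed configuration.\<close>
  have *: "override_on x (z(i := a)) (insert i S) = override_on (x(i := a)) z S" for z a
    using assms by (auto simp: override_on_def fun_eq_iff)
  have "marg (insert i S) g x =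
      (\<Sum>p\<in>UNIV \<times> configs S. g (override_on x ((\<lambda>(y, z). z(i := y)) p) (insert i S)))"
    unfolding marg_def configs_def PiE_insert_eq
    by (subst sum.reindex) (use inj_combinator[OF assms, of "\<lambda>_. UNIV"] in auto)
  also have "\<dots> = (\<Sum>a\<in>UNIV. marg S g (x(i := a)))"
    unfolding marg_def by (simp add: sum.cartesian_product split_def *)
  finally show ?thesis .
qed

lemma marg_union:
  fixes x :: "'v \<Rightarrow> 'x::finite"
  assumes "finite A" "A \<inter> B = {}"
  shows "marg (A \<union> B) g x = marg A (marg B g) x"
  using assms
proof (induction A arbitrary: x rule: finite_induct)
  case (insert i A)
  thus ?case by (simp add: marg_insert)
qed simp

lemma marg_mult_left:
  assumes "depends_on h S" "S \<inter> A = {}"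
  shows "marg A (\<lambda>w. h w * g w) x = h x * marg A g x"
proof -
  have "h (override_on x z A) = h x" for z
    by (rule depends_onD[OF assms(1)]) (use assms in \<open>auto simp: override_on_def\<close>)
  thus ?thesis by (simp add: marg_def sum_distrib_left)
qed

lemma marg_mult_right:
  assumes "depends_on h S" "S \<inter> A = {}"
  shows "marg A (\<lambda>w. g w * h w) x = marg A g x * h x"
  using marg_mult_left[OF assms, of g x] by (simp add: mult.commute)

lemma marg_sum: "marg A (\<lambda>w. \<Sum>a\<in>F. g a w) x = (\<Sum>a\<in>F. marg A (g a) x)"
  unfolding marg_def by (rule sum.swap)

lemma marg_depends_on:
  fixes g :: "('v \<Rightarrow> 'x) \<Rightarrow> real"
  assumes "depends_on g S"
  shows "depends_on (marg A g) (S - A)"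
  unfolding depends_on_def marg_def
proof (intro allI impI sum.cong refl)
  fix x y z :: "'v \<Rightarrow> 'x"
  assume "\<forall>v\<in>S - A. x v = y v"
  thus "g (override_on x z A) = g (override_on y z A)"
    by (intro depends_onD[OF assms]) (auto simp: override_on_def)
qed

text \<open>The distributive law behind the whole algorithm. The factors may share variables, as
  long as no factor sees a variable that is summed out in another one. By induction, the sums of the
  remaining factors are carried out first; their product is then constant in
  \<open>A k\<close>.\<close>

lemma marg_prod:
  fixes x :: "'v \<Rightarrow> 'x::finite"
  assumes "finite K" "\<And>k. k \<in> K \<Longrightarrow> finite (A k)" "\<And>k. k \<in> K \<Longrightarrow> depends_on (g k) (S k)"
    and "\<And>k k'. k \<in> K \<Longrightarrow> k' \<in> K \<Longrightarrow> k \<noteq> k' \<Longrightarrow> A k \<inter> A k' = {}"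
    and "\<And>k k'. k \<in> K \<Longrightarrow> k' \<in> K \<Longrightarrow> k \<noteq> k' \<Longrightarrow> S k \<inter> A k' = {}"
  shows "marg (\<Union>k\<in>K. A k) (\<lambda>w. \<Prod>k\<in>K. g k w) x = (\<Prod>k\<in>K. marg (A k) (g k) x)"
  using assms
proof (induction K arbitrary: x rule: finite_induct)
  case (insert k K)
  let ?U = "\<Union>k\<in>K. A k"
  have IH: "marg ?U (\<lambda>w. \<Prod>k\<in>K. g k w) w = (\<Prod>k\<in>K. marg (A k) (g k) w)" for w
    by (rule insert.IH) (use insert.prems in auto)
  have "A k \<inter> A k' = {}" "S k \<inter> A k' = {}" "S k' \<inter> A k = {}" if "k' \<in> K" for k'
    using that insert.prems(3)[of k k'] insert.prems(4)[of k k'] insert.prems(4)[of k' k] insert.hyps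
    by auto
  hence disj: "A k \<inter> ?U = {}" "S k \<inter> ?U = {}" "(\<Union>k\<in>K. S k - A k) \<inter> A k = {}" by blast+
  have "depends_on (\<lambda>w. \<Prod>k\<in>K. marg (A k) (g k) w) (\<Union>k\<in>K. S k - A k)"
    by (intro depends_on_prod marg_depends_on insert.prems) auto
  note right = marg_mult_right[OF this disj(3)]
  have left: "marg ?U (\<lambda>w. g k w * (\<Prod>k\<in>K. g k w)) = (\<lambda>w. g k w * (\<Prod>k\<in>K. marg (A k) (g k) w))"
    using marg_mult_left[of "g k" "S k" ?U] insert.prems(2)[of k] disj(2) IH by (simp add: fun_eq_iff)
  have "marg (\<Union>k\<in>insert k K. A k) (\<lambda>w. \<Prod>k\<in>insert k K. g k w) x =
      marg (A k \<union> ?U) (\<lambda>w. g k w * (\<Prod>k\<in>K. g k w)) x"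
    using insert.hyps by simp
  also have "\<dots> = marg (A k) (\<lambda>w. g k w * (\<Prod>k\<in>K. marg (A k) (g k) w)) x"
    by (subst marg_union) (use insert.prems(1) disj left in auto)
  also have "\<dots> = marg (A k) (g k) x * (\<Prod>k\<in>K. marg (A k) (g k) x)" by (rule right)
  finally show ?case using insert.hyps by simp
qed simp

subsection \<open>The opened network\<close>

locale opened_network =
  fixes N :: "('v, 'x::finite) cut_network"
  assumes gibbs: "gibbs_network N"
    and cutset_nodes: "cutset N \<subseteq> nodes N"
    and tree: "associated_tree N"
    and splitting: "potential_splitting N"
begin

lemma finite_nodes: "finite (nodes N)"
  using gibbs by (simp add: gibbs_network_def simple_graph_def)

lemma finite_cutset: "finite (cutset N)"
  using cutset_nodes finite_nodes by (rule finite_subset)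

lemma links_pair: "e \<in> links N \<Longrightarrow> \<exists>u\<in>nodes N. \<exists>v\<in>nodes N. u \<noteq> v \<and> e = {u, v}"
  using gibbs by (simp add: gibbs_network_def simple_graph_def)

lemma finite_links: "finite (links N)"
  using links_pair by (intro finite_subset[OF _ finite_Pow_iff[THEN iffD2, OF finite_nodes]]) blast

lemma link_nodes:
  assumes "{i, j} \<in> links N"
  shows "i \<in> nodes N" "j \<in> nodes N" "i \<noteq> j"
  using links_pair[OF assms] by (auto simp: doubleton_eq_iff)

lemma nbrs_iff: "j \<in> nbrs N i \<longleftrightarrow> {i, j} \<in> links N"
  by (simp add: nbrs_in_def)

lemma finite_nbrs: "finite (nbrs N i)"
  using link_nodes by (intro finite_subset[OF _ finite_nodes]) (auto simp: nbrs_iff)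

lemma ident_partition: "l \<in> cutset N \<Longrightarrow> partition_on (nbrs N l) (ident N l)"
  using tree by (simp add: associated_tree_def)

lemma block_link: "B \<in> blocks N i \<Longrightarrow> j \<in> B \<Longrightarrow> {i, j} \<in> links N"
  using ident_partition[of i] by (auto simp: blocks_def partition_on_def nbrs_iff split: if_splits)

lemma block_nbrs: "B \<in> blocks N i \<Longrightarrow> B \<subseteq> nbrs N i"
  using block_link by (auto simp: nbrs_iff)

lemma finite_block: "B \<in> blocks N i \<Longrightarrow> finite B"
  using block_nbrs finite_nbrs finite_subset by blast

lemma finite_blocks: "finite (blocks N i)"
  using block_nbrs by (intro finite_subset[OF _ finite_Pow_iff[THEN iffD2, OF finite_nbrs]]) blast

lemma finite_tree_nodes: "finite (tree_nodes N)"
  by (simp add: tree_nodes_def finite_nodes finite_blocks)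

lemma block_unique: "B \<in> blocks N i \<Longrightarrow> B' \<in> blocks N i \<Longrightarrow> j \<in> B \<Longrightarrow> j \<in> B' \<Longrightarrow> B = B'"
  using ident_partition[of i]
  by (auto simp: blocks_def partition_on_def disjoint_def split: if_splits)

text \<open>The blocks at one node are disjoint, so the definite description in
  \<open>copy_at\<close> has exactly one candidate.\<close>

lemma copy_at_eq: "B \<in> blocks N i \<Longrightarrow> j \<in> B \<Longrightarrow> copy_at N i j = (i, B)"
  unfolding copy_at_def by (auto intro!: the_equality dest: block_unique)

lemma copy_at_block:
  assumes "{i, j} \<in> links N"
  obtains B where "B \<in> blocks N i" "j \<in> B" "copy_at N i j = (i, B)"
proof -
  have "j \<in> nbrs N i" using assms by (simp add: nbrs_iff)
  hence "\<exists>B\<in>blocks N i. j \<in> B"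
    using ident_partition[of i] by (auto simp: blocks_def partition_on_def)
  with that copy_at_eq show thesis by blast
qed

lemma fst_copy_at [simp]: "fst (copy_at N i j) = i"
  by (simp add: copy_at_def)

lemma copy_at_in_tree_nodes: "{i, j} \<in> links N \<Longrightarrow> copy_at N i j \<in> tree_nodes N"
  by (erule copy_at_block) (auto simp: tree_nodes_def dest: block_link link_nodes(1))

lemma tree_link: "{i, j} \<in> links N \<Longrightarrow> {copy_at N i j, copy_at N j i} \<in> tree_links N"
  by (auto simp: tree_links_def)

lemma copy_at_neq: "{i, j} \<in> links N \<Longrightarrow> copy_at N i j \<noteq> copy_at N j i"
  using link_nodes(3) by (auto simp: copy_at_def)

lemma tree_links_cases:
  assumes "{p, q} \<in> tree_links N"
  obtains u v where "{u, v} \<in> links N" "p = copy_at N u v" "q = copy_at N v u"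
proof -
  from assms obtain i j where ij: "{i, j} \<in> links N"
      "{p, q} = {copy_at N i j, copy_at N j i}"
    by (auto simp: tree_links_def)
  with that[of i j] that[of j i] show thesis by (auto simp: doubleton_eq_iff insert_commute)
qed

text \<open>A tree link at \<open>(i, B)\<close> comes from a network link between \<open>i\<close>
  and some \<open>u\<close> whose attached copy of \<open>i\<close> is \<open>(i, B)\<close>, which
  means that \<open>u\<close> is in \<open>B\<close>.\<close>

lemma tree_nbr:
  assumes "{p, (i, B)} \<in> tree_links N" "B \<in> blocks N i"
  shows "\<exists>k\<in>B. p = copy_at N k i"
proof -
  obtain u v where uv: "{u, v} \<in> links N" "p = copy_at N u v" "(i, B) = copy_at N v u"
    using assms(1) by (rule tree_links_cases)
  hence "v = i" by (metis fst_conv fst_copy_at)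
  moreover have "{i, u} \<in> links N" using uv \<open>v = i\<close> by (simp add: insert_commute)
  hence "u \<in> B" by (rule copy_at_block) (use uv \<open>v = i\<close> in auto)
  ultimately show ?thesis using uv by auto
qed

lemma acyclic: "acyclic_graph (tree_links N)"
  using tree by (simp add: associated_tree_def)

lemma subtree_side: "subtree N j i = side (tree_links N) (copy_at N j i) (copy_at N i j)"
  by (simp add: subtree_def side_def insert_commute)

lemma subtree_self: "copy_at N j i \<in> subtree N j i"
  by (simp add: subtree_side side_self)

lemma subtree_step:
  assumes "{j, i} \<in> links N" "{u, v} \<in> links N" "copy_at N u v \<in> subtree N j i"
  shows "copy_at N v u \<in> subtree N j i \<or> copy_at N u v = copy_at N j i \<and> copy_at N v u = copy_at N i j"
  using side_edge[OF acyclic tree_link[OF assms(1)] copy_at_neq[OF assms(1)] _ tree_link[OF assms(2)]]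
    assms(3) by (simp add: subtree_side)

lemma subtree_opposite:
  assumes "{i, j} \<in> links N"
  shows "subtree N i j \<inter> subtree N j i = {}"
  unfolding subtree_side by (rule side_disjoint[OF acyclic tree_link[OF assms] copy_at_neq[OF assms]])

lemma subtree_nodes:
  assumes "{i, j} \<in> links N"
  shows "subtree N i j \<subseteq> tree_nodes N"
proof
  fix t assume "t \<in> subtree N i j"
  thus "t \<in> tree_nodes N"
    unfolding subtree_side
  proof (induction rule: side_induct)
    case base
    show ?case by (rule copy_at_in_tree_nodes[OF assms])
  next
    case (step u v)
    from \<open>{u, v} \<in> tree_links N\<close> obtain a b where "{a, b} \<in> links N" "v = copy_at N b a"
      by (rule tree_links_cases)
    thus ?case by (auto intro: copy_at_in_tree_nodes simp: insert_commute)
  qed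
qed

lemma finite_subtree: "{i, j} \<in> links N \<Longrightarrow> finite (subtree N i j)"
  using subtree_nodes finite_tree_nodes finite_subset by blast

section \<open>Branches hanging off a fixed copy\<close>

context
  fixes i B
  assumes iB: "i \<in> nodes N" "B \<in> blocks N i"
begin

lemma block_link_sym: "k \<in> B \<Longrightarrow> {k, i} \<in> links N"
  using block_link[OF iB(2), of k] by (simp add: insert_commute)

text \<open>The opened network is connected, so every copy is reached from \<open>(i, B)\<close>
  through one of its neighbours, and these are copies of members of \<open>B\<close>.\<close>

lemma branch_cover:
  assumes "t \<in> tree_nodes N"
  shows "t = (i, B) \<or> (\<exists>k\<in>B. t \<in> subtree N k i)"
proof -
  have "t \<in> component (tree_links N) (i, B)"
    using tree assms iB by (auto simp: associated_tree_def connected_graph_def tree_nodes_def)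
  moreover have "q \<noteq> (i, B)" if "{q, (i, B)} \<in> tree_links N" for q
    using tree_nbr[OF that iB(2)] block_link_sym link_nodes(3) by (auto simp: copy_at_def)
  ultimately consider "t = (i, B)" | q where "{q, (i, B)} \<in> tree_links N"
      "t \<in> side (tree_links N) q (i, B)"
    using component_cover[OF acyclic] by blast
  thus ?thesis
  proof cases
    case 2
    with tree_nbr iB(2) obtain k where "k \<in> B" "q = copy_at N k i" by blast
    with 2 copy_at_eq[OF iB(2)] show ?thesis by (auto simp: subtree_side)
  qed simp
qed

text \<open>Seen from \<open>j\<close>, the branches at the other members of \<open>B\<close> lie
  behind \<open>i\<close>.\<close>

lemma branch_subset:
  assumes "k \<in> B" "j \<in> B" "k \<noteq> j"
  shows "subtree N k i \<subseteq> subtree N i j"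
proof -
  have "copy_at N k i \<noteq> copy_at N j i" using assms by (auto simp: copy_at_def)
  with side_subset[OF acyclic tree_link[OF block_link_sym] copy_at_neq[OF block_link_sym]] assms
  show ?thesis by (simp add: subtree_side copy_at_eq[OF iB(2)])
qed

lemma branch_disjoint:
  assumes "k \<in> B" "j \<in> B" "k \<noteq> j"
  shows "subtree N k i \<inter> subtree N j i = {}"
  using branch_subset[OF assms] subtree_opposite[OF block_link_sym[OF assms(2)]] by blast

lemma root_notin_branch: "k \<in> B \<Longrightarrow> (i, B) \<notin> subtree N k i"
  using subtree_opposite[of k i] block_link_sym[of k] subtree_self[of i k] copy_at_eq[OF iB(2), of k]
  by auto

text \<open>Deleting the link to \<open>j\<close> cuts off the branch at \<open>j\<close> and
  nothing else. This is the tree form of the message recursion.\<close>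

lemma subtree_split:
  assumes "j \<in> B"
  shows "subtree N i j = insert (i, B) (\<Union>k\<in>B - {j}. subtree N k i)"
proof
  have "{i, j} \<in> links N" using block_link iB assms by blast
  note sub = subtree_nodes[OF this] subtree_opposite[OF this]
  show "subtree N i j \<subseteq> insert (i, B) (\<Union>k\<in>B - {j}. subtree N k i)"
  proof
    fix t assume t: "t \<in> subtree N i j"
    with sub have "t \<in> tree_nodes N" "t \<notin> subtree N j i" by auto
    with branch_cover[of t] show "t \<in> insert (i, B) (\<Union>k\<in>B - {j}. subtree N k i)" by auto
  qed
  show "insert (i, B) (\<Union>k\<in>B - {j}. subtree N k i) \<subseteq> subtree N i j"
    using branch_subset[OF _ assms] subtree_self[of i j] copy_at_eq[OF iB(2) assms] by auto
qed

end

lemma subtree_cover: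
  assumes "{i, j} \<in> links N"
  shows "subtree N i j \<union> subtree N j i = tree_nodes N"
proof -
  obtain B where B: "B \<in> blocks N i" "j \<in> B" using assms by (rule copy_at_block)
  have i: "i \<in> nodes N" using link_nodes assms by blast
  have "tree_nodes N \<subseteq> subtree N i j \<union> subtree N j i"
    using branch_cover[OF i B(1)] subtree_split[OF i B] by blast
  with subtree_nodes assms show ?thesis by (metis insert_commute Un_least subset_antisym)
qed

text \<open>The number of copies behind the sender is the measure for the inductions over messages;
  the branch of an incoming message omits the root \<open>(i, B)\<close>.\<close>

lemma card_subtree_less:
  assumes "{i, j} \<in> links N" "B \<in> blocks N i" "j \<in> B" "k \<in> B" "k \<noteq> j"
  shows "card (subtree N k i) < card (subtree N i j)"
proof (rule psubset_card_mono[OF finite_subtree[OF assms(1)]])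
  have "i \<in> nodes N" using assms link_nodes by blast
  note iB = this assms(2)
  show "subtree N k i \<subset> subtree N i j"
    using subtree_split[OF iB assms(3)] root_notin_branch[OF iB assms(4)] assms(4,5) by auto
qed

subsection \<open>Leaf and non-leaf copies\<close>

text \<open>The neighbours of \<open>(l, B)\<close> are copies of the members of \<open>B\<close>,
  one for each member, so its degree is the size of \<open>B\<close>.\<close>

lemma leaf_nbrs_iff:
  assumes "l \<in> cutset N" "B \<in> ident N l" "j \<in> B"
  shows "j \<in> leaf_nbrs N l \<longleftrightarrow> B = {j}"
proof -
  have B: "B \<in> blocks N l" using assms by (simp add: blocks_def)
  have "nbrs_in (tree_links N) (l, B) = (\<lambda>k. copy_at N k l) ` B"
  proof (intro equalityI subsetI)
    fix p assume "p \<in> nbrs_in (tree_links N) (l, B)"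
    hence "{p, (l, B)} \<in> tree_links N" by (simp add: nbrs_in_def insert_commute)
    from tree_nbr[OF this B] show "p \<in> (\<lambda>k. copy_at N k l) ` B" by blast
  next
    fix p assume "p \<in> (\<lambda>k. copy_at N k l) ` B"
    then obtain k where "k \<in> B" "p = copy_at N k l" by blast
    with tree_link[OF block_link[OF B]] copy_at_eq[OF B] show "p \<in> nbrs_in (tree_links N) (l, B)"
      by (auto simp: nbrs_in_def)
  qed
  moreover have "inj_on (\<lambda>k. copy_at N k l) B" by (rule inj_onI) (simp add: copy_at_def)
  ultimately have "card (nbrs_in (tree_links N) (l, B)) = card B" by (simp add: card_image)
  hence "j \<in> leaf_nbrs N l \<longleftrightarrow> card B = 1"
    using block_nbrs[OF B] assms(3) copy_at_eq[OF B assms(3)] by (auto simp: leaf_nbrs_def)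
  with assms(3) show ?thesis by (auto simp: card_1_singleton_iff)
qed

lemma nbr_ident:
  assumes "l \<in> cutset N" "j \<in> nbrs N l"
  obtains B where "B \<in> ident N l" "j \<in> B"
  using ident_partition[OF assms(1)] assms(2) that by (auto simp: partition_on_def)

lemma leaf_ident:
  assumes "l \<in> cutset N" "j \<in> leaf_nbrs N l"
  shows "{j} \<in> ident N l"
proof -
  have "j \<in> nbrs N l" using assms by (simp add: leaf_nbrs_def)
  with assms(1) obtain B where "B \<in> ident N l" "j \<in> B" by (rule nbr_ident)
  with leaf_nbrs_iff[of l B j] assms show ?thesis by simp
qed

lemma inner_ident: "l \<in> cutset N \<Longrightarrow> inner_nbrs N l \<noteq> {} \<Longrightarrow> inner_nbrs N l \<in> ident N l"
  using tree by (simp add: associated_tree_def)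

text \<open>If \<open>j\<close> is not a leaf neighbour, then \<open>inner_nbrs N l\<close> is
  itself a block containing \<open>j\<close>, and blocks are disjoint.\<close>

lemma ident_cases:
  assumes "l \<in> cutset N" "B \<in> ident N l" "j \<in> B"
  shows "j \<in> leaf_nbrs N l \<and> B = {j} \<or> j \<notin> leaf_nbrs N l \<and> B = inner_nbrs N l"
proof (cases "j \<in> leaf_nbrs N l")
  case False
  have "j \<in> nbrs N l" using block_link[of B l j] assms by (simp add: blocks_def nbrs_iff)
  with False have j: "j \<in> inner_nbrs N l" by (simp add: inner_nbrs_def)
  hence "inner_nbrs N l \<in> ident N l" using inner_ident assms by blast
  with j assms block_unique[of B l "inner_nbrs N l" j] False show ?thesis by (simp add: blocks_def)
qed (use leaf_nbrs_iff[OF assms] in simp)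

text \<open>The exponents of the copies add up to 1, whereas an empty sum is 0. A node without
  copies would satisfy the condition in \<open>upstream\<close> vacuously.\<close>

lemma ident_nonempty:
  assumes "l \<in> cutset N"
  shows "ident N l \<noteq> {}"
proof
  assume "ident N l = {}"
  with splitting assms show False by (force simp: potential_splitting_def)
qed

text \<open>All blocks that are not leaves coincide with \<open>inner_nbrs N l\<close>, so two
  blocks require a leaf. This makes the choice of some leaf neighbour in the belief rule
  possible.\<close>

lemma split_leaf:
  assumes "l \<in> cutset N" "is_split N l"
  shows "leaf_nbrs N l \<noteq> {}"
proof
  assume no: "leaf_nbrs N l = {}"
  have "B = inner_nbrs N l" if "B \<in> ident N l" for B
  proof -
    have "B \<noteq> {}" using ident_partition[OF assms(1)] that by (auto simp: partition_on_def)
    with no ident_cases[OF assms(1) that] show ?thesis by blast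
  qed
  hence "ident N l \<subseteq> {inner_nbrs N l}" by blast
  hence "card (ident N l) \<le> 1" using card_mono[of "{inner_nbrs N l}"] by simp
  with assms(2) show False by (simp add: is_split_def)
qed

subsection \<open>Conditioned messages\<close>

text \<open>Every recursive call descends into a strictly smaller branch, so the partial function is
  defined on all links.\<close>

lemma cond_msg_dom:
  assumes "{i, j} \<in> links N"
  shows "cond_msg_dom (N, x, i, j)"
  using assms
proof (induction "card (subtree N i j)" arbitrary: i j rule: less_induct)
  case less
  obtain B where B: "B \<in> blocks N i" "j \<in> B" using less.prems by (rule copy_at_block)
  have IH: "cond_msg_dom (N, x, k, i)" if "k \<in> B" "k \<noteq> j" for k
    using card_subtree_less[OF less.prems B that] block_link[OF B(1) that(1)]
    by (intro less.hyps) (auto simp: insert_commute)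
  show ?case
  proof (rule cond_msg.domintros)
    fix k assume "i \<notin> cutset N" "k \<in> nbrs N i" "k \<noteq> j"
    with B IH show "cond_msg_dom (N, x, k, i)" by (simp add: blocks_def)
  next
    fix k assume *: "i \<in> cutset N" "j \<notin> leaf_nbrs N i" "k \<in> inner_nbrs N i" "k \<noteq> j"
    hence "B = inner_nbrs N i" using B ident_cases[of i B j] by (simp add: blocks_def)
    with * IH show "cond_msg_dom (N, x, k, i)" by simp
  qed
qed

text \<open>Not clamped, since the Gibbs weight is factored over the copies before any value is
  fixed.\<close>

definition copy_pot :: "'v \<Rightarrow> 'v set \<Rightarrow> 'x \<Rightarrow> real" where
  "copy_pot i B a = (if i \<in> cutset N then self_pot N i a powr expo N i B else self_pot N i a)"

text \<open>Clamps cutset nodes only, so that one formula serves both kinds of nodes.\<close>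

definition node_pot :: "'v \<Rightarrow> 'v set \<Rightarrow> ('v \<Rightarrow> 'x) \<Rightarrow> 'x \<Rightarrow> real" where
  "node_pot i B x a = copy_pot i B a * (if i \<in> cutset N \<and> a \<noteq> x i then 0 else 1)"

lemma node_pot_free: "i \<notin> cutset N \<Longrightarrow> node_pot i B x a = self_pot N i a"
  by (simp add: node_pot_def copy_pot_def)

lemma node_pot_cutset: "i \<in> cutset N \<Longrightarrow> node_pot i B x a = clamped_pot N i B (x i) a"
  by (simp add: node_pot_def copy_pot_def clamped_pot_def)

text \<open>The three cases of \<open>cond_msg\<close> merge: at a leaf copy the block is
  \<open>{j}\<close> and the product is empty, and otherwise \<open>B\<close> is the set over which
  the recursion runs.\<close>

lemma cond_msg_rec:
  assumes "B \<in> blocks N i" "j \<in> B"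
  shows "cond_msg N x i j =
    edge_act N i j (\<lambda>a. node_pot i B x a * (\<Prod>k\<in>B - {j}. cond_msg N x k i a))"
proof (cases "i \<in> cutset N")
  case True
  with ident_cases[of i B j] assms have "j \<in> leaf_nbrs N i \<and> B = {j} \<or> j \<notin> leaf_nbrs N i \<and> B = inner_nbrs N i"
    by (simp add: blocks_def)
  thus ?thesis
    using cond_msg.psimps[OF cond_msg_dom[OF block_link[OF assms]]] True
    by (auto simp: node_pot_cutset)
next
  case False
  thus ?thesis
    using cond_msg.psimps[OF cond_msg_dom[OF block_link[OF assms]]] assms
    by (simp add: node_pot_free blocks_def)
qed

text \<open>Asks for at least one copy behind the sender, where \<open>upstream\<close> asks for all
  copies. These are the cutset nodes that a conditioned message may depend on.\<close>

definition touched :: "'v \<Rightarrow> 'v \<Rightarrow> 'v set" where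
  "touched i j = cutset N \<inter> fst ` subtree N i j"

lemma touchedE:
  assumes "l \<in> touched i j" "{i, j} \<in> links N"
  obtains B where "B \<in> ident N l" "(l, B) \<in> subtree N i j"
  using assms subtree_nodes[OF assms(2)] that by (force simp: touched_def tree_nodes_def blocks_def)

lemma cond_msg_depends_on:
  assumes "{i, j} \<in> links N"
  shows "depends_on (\<lambda>x. cond_msg N x i j a) (touched i j)"
  using assms
proof (induction "card (subtree N i j)" arbitrary: i j a rule: less_induct)
  case less
  obtain B where B: "B \<in> blocks N i" "j \<in> B" using less.prems by (rule copy_at_block)
  have i: "i \<in> nodes N" using less.prems link_nodes by blast
  have "depends_on (\<lambda>x. cond_msg N x k i a) (touched i j)" if "k \<in> B" "k \<noteq> j" for k a
  proof (rule depends_on_mono)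
    show "depends_on (\<lambda>x. cond_msg N x k i a) (touched k i)"
      using card_subtree_less[OF less.prems B that] block_link[OF B(1) that(1)]
      by (intro less.hyps) (auto simp: insert_commute)
    show "touched k i \<subseteq> touched i j"
      using branch_subset[OF i B(1) that(1) B(2) that(2)] by (auto simp: touched_def)
  qed
  hence msg: "cond_msg N x k i a = cond_msg N y k i a"
    if "k \<in> B - {j}" "\<forall>v\<in>touched i j. x v = y v" for x y k a
    using that by (auto simp: depends_on_def)
  have "i \<in> touched i j" if "i \<in> cutset N"
    using that subtree_split[OF i B] by (auto simp: touched_def image_iff)
  hence "node_pot i B x a = node_pot i B y a" if "\<forall>v\<in>touched i j. x v = y v" for x y a
    using that by (auto simp: node_pot_def)
  with msg show ?case
    unfolding depends_on_def cond_msg_rec[OF B] edge_act_def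
    by (intro allI impI sum.cong refl arg_cong2[of _ _ _ _ "(*)"] prod.cong) auto
qed

subsection \<open>Relevant sets\<close>

lemma rel_edge_commute: "rel_edge N i j = rel_edge N j i"
  by (simp add: rel_edge_def Un_commute)

lemma rel_edge_cutset: "rel_edge N i j \<subseteq> cutset N"
  by (auto simp: rel_edge_def)

lemma rel_node_cutset: "rel_node N i S \<subseteq> cutset N"
  using rel_edge_cutset by (auto simp: rel_node_def)

lemma upstream_cutset: "upstream N i j \<subseteq> cutset N"
  by (auto simp: upstream_def)

lemma finite_upstream: "finite (upstream N i j)"
  using finite_cutset upstream_cutset by (rule finite_subset[rotated])

lemma finite_UN_upstream: "finite (\<Union>k\<in>B. upstream N (f k) (g k))"
  using upstream_cutset by (intro finite_subset[OF _ finite_cutset]) blast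

lemma cutset_copy: "l \<in> cutset N \<Longrightarrow> B \<in> ident N l \<Longrightarrow> (l, B) \<in> tree_nodes N"
  using cutset_nodes by (auto simp: tree_nodes_def blocks_def)

lemma touched_disjoint_upstream:
  assumes "{i, j} \<in> links N" "subtree N i j \<inter> subtree N i' j' = {}"
  shows "touched i j \<inter> upstream N i' j' = {}"
  using assms by (fastforce elim: touchedE simp: upstream_def)

text \<open>The two subtrees at a link partition the tree: a cutset node has a copy on one side
  exactly when its copies do not all lie on the other.\<close>

lemma touched_eq:
  assumes "{i, j} \<in> links N"
  shows "touched i j = rel_edge N i j \<union> upstream N i j"
proof (intro equalityI subsetI)
  fix l assume l: "l \<in> touched i j"
  hence "l \<in> cutset N" by (simp add: touched_def)
  moreover have "l \<notin> upstream N j i"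
    using touched_disjoint_upstream[OF assms subtree_opposite[OF assms]] l by blast
  ultimately show "l \<in> rel_edge N i j \<union> upstream N i j" by (auto simp: rel_edge_def)
next
  fix l assume l: "l \<in> rel_edge N i j \<union> upstream N i j"
  hence lc: "l \<in> cutset N" using rel_edge_cutset upstream_cutset by blast
  have "\<exists>B\<in>ident N l. (l, B) \<in> subtree N i j"
  proof (cases "l \<in> upstream N i j")
    case True
    thus ?thesis using ident_nonempty[OF lc] by (auto simp: upstream_def)
  next
    case False
    with l have "l \<notin> upstream N j i" by (auto simp: rel_edge_def)
    with lc obtain B where B: "B \<in> ident N l" "(l, B) \<notin> subtree N j i" by (auto simp: upstream_def)
    with cutset_copy[OF lc B(1)] subtree_cover[OF assms] show ?thesis by blast
  qed
  with lc show "l \<in> touched i j" by (force simp: touched_def)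
qed

lemma local_msg_marg: "local_msg N j i x a = marg (upstream N j i) (\<lambda>w. cond_msg N w j i a) x"
  by (simp add: local_msg_def marg_def)

text \<open>Summing out the upstream nodes leaves only the relevant ones among the touched nodes.
  Hence a local message may be evaluated at the restriction of a larger configuration.\<close>

lemma local_msg_depends_on:
  assumes "{j, i} \<in> links N"
  shows "depends_on (\<lambda>x. local_msg N j i x a) (rel_edge N j i)"
  unfolding local_msg_marg
  by (rule depends_on_mono[OF marg_depends_on[OF cond_msg_depends_on[OF assms]]])
    (auto simp: touched_eq[OF assms])

lemma local_msg_restrict:
  assumes "{j, i} \<in> links N"
  shows "local_msg N j i (restrict x (rel_edge N j i)) a = local_msg N j i x a"
  by (rule depends_onD[OF local_msg_depends_on[OF assms]]) simp

section \<open>Relevant sets and local messages around a fixed copy\<close>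

context
  fixes i B
  assumes iB: "i \<in> nodes N" "B \<in> blocks N i"
begin

lemma root_notin_upstream: "k \<in> B \<Longrightarrow> i \<notin> upstream N k i"
  using root_notin_branch[OF iB, of k] iB(2) by (auto simp: upstream_def blocks_def)

lemma touched_upstream_siblings:
  assumes "k \<in> B" "j \<in> B" "k \<noteq> j"
  shows "touched k i \<inter> upstream N j i = {}"
  by (rule touched_disjoint_upstream[OF block_link_sym[OF iB] branch_disjoint[OF iB]])
    (use assms in auto)

lemma upstream_disjoint_siblings:
  assumes "k \<in> B" "j \<in> B" "k \<noteq> j"
  shows "upstream N k i \<inter> upstream N j i = {}"
  using touched_upstream_siblings[OF assms] touched_eq[OF block_link_sym[OF iB assms(1)]] by blast

lemma rel_edge_upstream_siblings:
  assumes "k \<in> B" "j \<in> B" "k \<noteq> j"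
  shows "rel_edge N k i \<inter> upstream N j i = {}"
  using touched_upstream_siblings[OF assms] touched_eq[OF block_link_sym[OF iB assms(1)]] by blast

lemma upstream_subset: "k \<in> B \<Longrightarrow> j \<in> B \<Longrightarrow> k \<noteq> j \<Longrightarrow> upstream N k i \<subseteq> upstream N i j"
  using branch_subset[OF iB, of k j] by (auto simp: upstream_def)

text \<open>Sibling branches may share relevant nodes, but a message never depends on a node all of
  whose copies lie in another branch, so the upstream sums separate.\<close>

lemma marg_prod_cond_msg:
  assumes "K \<subseteq> B"
  shows "marg (\<Union>k\<in>K. upstream N k i) (\<lambda>w. \<Prod>k\<in>K. cond_msg N w k i a) x =
    (\<Prod>k\<in>K. local_msg N k i x a)"
  unfolding local_msg_marg
proof (rule marg_prod)
  show "finite K" using assms finite_block[OF iB(2)] by (rule finite_subset)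
  show "finite (upstream N k i)" for k by (rule finite_upstream)
  show "depends_on (\<lambda>w. cond_msg N w k i a) (touched k i)" if "k \<in> K" for k
    using that assms by (intro cond_msg_depends_on block_link_sym[OF iB]) auto
  show "upstream N k i \<inter> upstream N k' i = {}" "touched k i \<inter> upstream N k' i = {}"
    if "k \<in> K" "k' \<in> K" "k \<noteq> k'" for k k'
    using that assms upstream_disjoint_siblings[of k k'] touched_upstream_siblings[of k k'] by auto
qed

text \<open>
  A cutset node with a single copy has to be excluded below: its copy is the root \<open>(i, B)\<close> itself,
  so it is relevant to no edge but also upstream of no branch at the root.
\<close>

context
  assumes split: "i \<in> cutset N \<Longrightarrow> is_split N i"
begin

text \<open>A node upstream of every message leaving the root has no copy in any branch. Its only
  copy would be the root \<open>(i, B)\<close>, against \<open>split\<close>.\<close>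

lemma copy_in_branch:
  assumes "l \<in> cutset N"
  shows "\<exists>k\<in>B. l \<notin> upstream N i k"
proof (rule ccontr)
  assume "\<not> (\<exists>k\<in>B. l \<notin> upstream N i k)"
  hence up: "l \<in> upstream N i k" if "k \<in> B" for k using that by blast
  have "B' = B \<and> l = i" if B': "B' \<in> ident N l" for B'
  proof -
    have "(l, B') \<notin> subtree N k i" if "k \<in> B" for k
      using up[OF that] B' subtree_opposite[OF block_link_sym[OF iB that]] by (auto simp: upstream_def)
    with branch_cover[OF iB cutset_copy[OF assms B']] show ?thesis by auto
  qed
  hence *: "ident N l \<subseteq> {B}" "ident N l \<noteq> {} \<longrightarrow> l = i" by auto
  with ident_nonempty[OF assms] have "is_split N l" using split assms by auto
  moreover have "card (ident N l) \<le> 1" using card_mono[OF _ *(1)] by simp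
  ultimately show False by (simp add: is_split_def)
qed

text \<open>An irrelevant node lies on one side of each link at the root, and by
  \<open>copy_in_branch\<close> it is on the branch side of some link. Conversely, a node confined
  to one branch lies behind the root for all other links.\<close>

lemma cutset_minus_rel_node: "cutset N - rel_node N i B = (\<Union>k\<in>B. upstream N k i)"
proof (intro equalityI subsetI)
  fix l assume l: "l \<in> cutset N - rel_node N i B"
  then obtain k where "k \<in> B" "l \<notin> upstream N i k" using copy_in_branch by blast
  with l show "l \<in> (\<Union>k\<in>B. upstream N k i)" by (auto simp: rel_node_def rel_edge_def)
next
  fix l assume "l \<in> (\<Union>k\<in>B. upstream N k i)"
  then obtain k where k: "k \<in> B" "l \<in> upstream N k i" by blast
  hence "l \<notin> rel_edge N i j" if "j \<in> B" for j
    using that upstream_subset[of k j] by (cases "k = j") (auto simp: rel_edge_def)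
  with k show "l \<in> cutset N - rel_node N i B"
    using upstream_cutset by (auto simp: rel_node_def)
qed

lemma root_in_rel_node: "i \<in> cutset N \<Longrightarrow> i \<in> rel_node N i B"
  using cutset_minus_rel_node root_notin_upstream by blast

text \<open>Confirms the verbal description of the summation set. A node relevant to a link at
  \<open>k\<close> is upstream of no incoming message, so if it is irrelevant to the link at
  \<open>j\<close> it must be upstream of the outgoing one; the converse uses
  \<open>copy_in_branch\<close>.\<close>

lemma sum_set_eq:
  assumes "j \<in> B"
  shows "sum_set N B i j = upstream N i j - (\<Union>k\<in>B - {j}. upstream N k i)"
proof (intro equalityI subsetI)
  fix l assume "l \<in> sum_set N B i j"
  then obtain k where k: "k \<in> B" "k \<noteq> j" "l \<in> rel_edge N k i" "l \<notin> rel_edge N j i"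
    by (auto simp: sum_set_def)
  have "l \<notin> upstream N k' i" if "k' \<in> B" for k'
    using rel_edge_upstream_siblings[OF k(1) that] k(3) by (cases "k = k'") (auto simp: rel_edge_def)
  with k assms show "l \<in> upstream N i j - (\<Union>k\<in>B - {j}. upstream N k i)"
    using rel_edge_cutset by (auto simp: rel_edge_def)
next
  fix l assume l: "l \<in> upstream N i j - (\<Union>k\<in>B - {j}. upstream N k i)"
  hence "l \<in> cutset N" using upstream_cutset by blast
  then obtain k where k: "k \<in> B" "l \<notin> upstream N i k" using copy_in_branch by blast
  with l have "k \<noteq> j" by blast
  with k l \<open>l \<in> cutset N\<close> have "l \<in> rel_edge N k i" by (auto simp: rel_edge_def)
  with k \<open>k \<noteq> j\<close> l show "l \<in> sum_set N B i j" by (auto simp: sum_set_def rel_edge_def)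
qed

text \<open>The upstream sum splits into \<open>sum_set\<close> and the upstream sets of the
  incoming messages; the latter sums turn conditioned messages into local ones. The potential stays
  under the outer sum: if all copies of a cutset node \<open>i\<close> lie behind \<open>i\<close>,
  its own value is among those summed.\<close>

lemma local_msg_rec:
  assumes "j \<in> B"
  shows "local_msg N i j x = edge_act N i j (\<lambda>a. \<Sum>y\<in>configs (sum_set N B i j).
    node_pot i B (override_on x y (sum_set N B i j)) a *
    (\<Prod>k\<in>B - {j}. local_msg N k i (override_on x y (sum_set N B i j)) a))"
proof
  fix b
  let ?U = "\<Union>k\<in>B - {j}. upstream N k i" and ?S = "sum_set N B i j"
  let ?m = "\<lambda>a w. node_pot i B w a * (\<Prod>k\<in>B - {j}. cond_msg N w k i a)"
  have S: "?S = upstream N i j - ?U" by (rule sum_set_eq[OF assms])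
  have "?U \<subseteq> upstream N i j" using upstream_subset[OF _ assms] by blast
  hence US: "upstream N i j = ?S \<union> ?U" "?S \<inter> ?U = {}" by (auto simp: S)
  have "finite ?S" unfolding S using finite_upstream by simp
  \<comment> \<open>The potential sees only the value at \<open>i\<close>, and \<open>i\<close> is
    upstream of no incoming message, so it passes through the inner sum.\<close>
  have "depends_on (\<lambda>w. node_pot i B w a) {i}" for a
    by (simp add: depends_on_def node_pot_def)
  moreover have "{i} \<inter> ?U = {}" using root_notin_upstream by blast
  ultimately have inner: "marg ?U (?m a) = (\<lambda>w. node_pot i B w a * (\<Prod>k\<in>B - {j}. local_msg N k i w a))" for a
    by (intro ext) (simp add: marg_mult_left[of _ "{i}"] marg_prod_cond_msg)
  have "local_msg N i j x b = marg (?S \<union> ?U) (\<lambda>w. \<Sum>a\<in>UNIV. edge_pot N i j a b * ?m a w) x"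
    unfolding local_msg_marg US(1)[symmetric] cond_msg_rec[OF iB(2) assms] edge_act_def ..
  also have "\<dots> = (\<Sum>a\<in>UNIV. edge_pot N i j a b * marg (?S \<union> ?U) (?m a) x)"
    unfolding marg_sum by (intro sum.cong refl marg_mult_left[where S = "{}"]) (auto simp: depends_on_def)
  also have "\<dots> = (\<Sum>a\<in>UNIV. edge_pot N i j a b *
      marg ?S (\<lambda>w. node_pot i B w a * (\<Prod>k\<in>B - {j}. local_msg N k i w a)) x)"
    by (simp only: marg_union[OF \<open>finite ?S\<close> US(2)] inner)
  finally show "local_msg N i j x b = edge_act N i j (\<lambda>a. \<Sum>y\<in>configs ?S.
    node_pot i B (override_on x y ?S) a *
    (\<Prod>k\<in>B - {j}. local_msg N k i (override_on x y ?S) a)) b"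
    by (simp add: edge_act_def marg_def)
qed

end

end

text \<open>Apart from the leaf copy itself, the tree is the single branch at \<open>k\<close>. It
  contains all copies of every other cutset node, so only \<open>l\<close> can be relevant.\<close>

lemma rel_edge_leaf:
  assumes "l \<in> cutset N" "is_split N l" "k \<in> leaf_nbrs N l"
  shows "rel_edge N l k = {l}"
proof -
  have iB: "l \<in> nodes N" "{k} \<in> blocks N l"
    using assms cutset_nodes leaf_ident by (auto simp: blocks_def)
  have "l' \<in> upstream N k l" if l': "l' \<in> cutset N" "l' \<noteq> l" for l'
    using branch_cover[OF iB cutset_copy[OF l'(1)]] l' by (auto simp: upstream_def)
  with cutset_minus_rel_node[OF iB assms(2)] root_in_rel_node[OF iB assms(2,1)]
  show ?thesis using rel_edge_cutset[of l k] by (auto simp: rel_node_def)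
qed

lemma nbrs_split: "nbrs N l = inner_nbrs N l \<union> leaf_nbrs N l"
  by (auto simp: inner_nbrs_def leaf_nbrs_def)

context
  fixes l
  assumes l: "l \<in> cutset N" "is_split N l" "inner_nbrs N l \<noteq> {}"
begin

lemma inner_block: "l \<in> nodes N" "inner_nbrs N l \<in> blocks N l"
  using l cutset_nodes inner_ident by (auto simp: blocks_def)

lemma rel_node_nbrs: "rel_node N l (nbrs N l) = rel_node N l (inner_nbrs N l)"
  using root_in_rel_node[OF inner_block] rel_edge_leaf[OF l(1,2)] l
  by (auto simp: nbrs_split rel_node_def)

text \<open>Links to leaf neighbours contribute only \<open>l\<close>. If \<open>l\<close> is
  relevant to the link at \<open>i\<close>, it is subtracted anyway; otherwise it is already
  relevant to another link of the non-leaf copy.\<close>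

lemma sum_set_nbrs: "i \<in> inner_nbrs N l \<Longrightarrow> sum_set N (nbrs N l) l i = sum_set N (inner_nbrs N l) l i"
  using root_in_rel_node[OF inner_block] rel_edge_leaf[OF l(1,2)] l
  by (auto simp: nbrs_split rel_node_def sum_set_def rel_edge_commute[of _ l])

end

subsection \<open>Factorization of the Gibbs weight along the tree\<close>

text \<open>The choice in \<open>edge_weight\<close> may return either orientation; the symmetry of
  the edge potentials makes the values agree.\<close>

lemma edge_weight_eq:
  assumes "{i, j} \<in> links N"
  shows "edge_weight N {i, j} w = edge_pot N i j (w i) (w j)"
proof -
  obtain u v where uv: "(SOME p. case p of (u, v) \<Rightarrow> {i, j} = {u, v}) = (u, v)"
    by (meson surj_pair)
  have "case (SOME p. case p of (u, v) \<Rightarrow> {i, j} = {u, v}) of (u, v) \<Rightarrow> {i, j} = {u, v}"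
    by (rule someI[of _ "(i, j)"]) simp
  hence "{i, j} = {u, v}" by (simp add: uv)
  moreover have "edge_pot N i j a b = edge_pot N j i b a" for a b
    using gibbs assms unfolding gibbs_network_def by blast
  moreover have "edge_weight N {i, j} w = edge_pot N u v (w u) (w v)"
    by (simp add: edge_weight_def uv)
  ultimately show ?thesis by (auto simp: doubleton_eq_iff)
qed

definition gibbs_weight :: "('v \<Rightarrow> 'x) \<Rightarrow> real" where
  "gibbs_weight w = (\<Prod>e\<in>links N. edge_weight N e w) * (\<Prod>v\<in>nodes N. self_pot N v (w v))"

text \<open>One end copy in the branch suffices, so the connecting link \<open>{k, j}\<close> is
  included and the weight of a branch also depends on the value at the receiver
  \<open>j\<close>.\<close>

definition branch_links :: "'v \<Rightarrow> 'v \<Rightarrow> 'v set set" where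
  "branch_links k j = {{u, v} | u v. {u, v} \<in> links N \<and> copy_at N u v \<in> subtree N k j}"

lemma branch_linksI:
  "e \<in> links N \<Longrightarrow> e = {u, v} \<Longrightarrow> copy_at N u v \<in> subtree N k j \<Longrightarrow> e \<in> branch_links k j"
  by (auto simp: branch_links_def)

definition branch_weight :: "'v \<Rightarrow> 'v \<Rightarrow> ('v \<Rightarrow> 'x) \<Rightarrow> real" where
  "branch_weight k j w = (\<Prod>e\<in>branch_links k j. edge_weight N e w) *
     (\<Prod>(v, B)\<in>subtree N k j. copy_pot v B (w v))"

text \<open>Such a node has a single copy, so disjoint branches have disjoint sets of free
  nodes.\<close>

definition free_nodes :: "'v \<Rightarrow> 'v \<Rightarrow> 'v set" where
  "free_nodes k j = fst ` subtree N k j - cutset N"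

lemma finite_branch_links: "finite (branch_links k j)"
  by (rule finite_subset[OF _ finite_links]) (auto simp: branch_links_def)

lemma free_nodesD:
  assumes "{k, j} \<in> links N" "v \<in> free_nodes k j"
  shows "(v, nbrs N v) \<in> subtree N k j" "v \<notin> cutset N" "v \<in> nodes N"
  using assms(2) subtree_nodes[OF assms(1)] by (auto simp: free_nodes_def tree_nodes_def blocks_def)

lemma finite_free_nodes: "{k, j} \<in> links N \<Longrightarrow> finite (free_nodes k j)"
  using finite_subtree by (simp add: free_nodes_def)

lemma receiver_not_free:
  assumes "{k, j} \<in> links N"
  shows "j \<notin> free_nodes k j"
proof
  assume "j \<in> free_nodes k j"
  note j = free_nodesD[OF assms this]
  have "copy_at N j k = (j, nbrs N j)"
    using j(2) assms by (intro copy_at_eq) (auto simp: blocks_def nbrs_iff insert_commute)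
  with j(1) subtree_self[of j k] subtree_opposite[OF assms] show False by auto
qed

lemma free_nodes_disjoint:
  assumes "{k, j} \<in> links N" "subtree N k j \<inter> subtree N k' j' = {}" "{k', j'} \<in> links N"
  shows "fst ` subtree N k j \<inter> free_nodes k' j' = {}"
proof (rule ccontr)
  assume "fst ` subtree N k j \<inter> free_nodes k' j' \<noteq> {}"
  then obtain v where v: "v \<in> fst ` subtree N k j" "v \<in> free_nodes k' j'" by blast
  hence "v \<in> free_nodes k j" by (auto simp: free_nodes_def)
  with free_nodesD(1)[OF assms(1)] free_nodesD(1)[OF assms(3)] v assms(2) show False by blast
qed

lemma branch_weight_depends_on:
  assumes "{k, j} \<in> links N"
  shows "depends_on (branch_weight k j) (insert j (fst ` subtree N k j))"
proof -
  have "edge_weight N e x = edge_weight N e y"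
    if e: "e \<in> branch_links k j" and agree: "\<forall>v\<in>insert j (fst ` subtree N k j). x v = y v" for e x y
  proof -
    from e obtain u v where uv: "e = {u, v}" "{u, v} \<in> links N" "copy_at N u v \<in> subtree N k j"
      by (auto simp: branch_links_def)
    have "u \<in> fst ` subtree N k j" using uv(3) by (metis fst_copy_at imageI)
    moreover have "v \<in> insert j (fst ` subtree N k j)"
      using subtree_step[OF assms uv(2,3)] by (metis fst_copy_at imageI insertCI)
    ultimately have "x u = y u" "x v = y v" using agree by blast+
    with uv show ?thesis by (simp add: edge_weight_eq)
  qed
  moreover have "copy_pot (fst t) (snd t) (x (fst t)) = copy_pot (fst t) (snd t) (y (fst t))"
    if "t \<in> subtree N k j" "\<forall>v\<in>insert j (fst ` subtree N k j). x v = y v" for t and x y :: "'v \<Rightarrow> 'x"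
    using that by simp
  ultimately show ?thesis
    unfolding depends_on_def branch_weight_def split_def
    by (intro allI impI arg_cong2[of _ _ _ _ "(*)"] prod.cong refl) blast+
qed

text \<open>The powers of the positive self potential multiply to the power of the exponent sum,
  which is 1.\<close>

lemma prod_copy_pot:
  assumes "v \<in> nodes N"
  shows "(\<Prod>B\<in>blocks N v. copy_pot v B a) = self_pot N v a"
proof (cases "v \<in> cutset N")
  case True
  have "self_pot N v a > 0" using gibbs assms by (simp add: gibbs_network_def)
  moreover have "finite (ident N v)" using finite_blocks[of v] True by (simp add: blocks_def)
  moreover have "(\<Sum>B\<in>ident N v. expo N v B) = 1"
    using splitting True by (simp add: potential_splitting_def)
  ultimately have "(\<Prod>B\<in>ident N v. self_pot N v a powr expo N v B) = self_pot N v a"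
    using powr_sum[of "self_pot N v a" "expo N v" "ident N v"] by simp
  with True show ?thesis by (simp add: copy_pot_def blocks_def)
qed (simp add: copy_pot_def blocks_def)

lemma gibbs_weight_tree:
  "gibbs_weight w = (\<Prod>e\<in>links N. edge_weight N e w) * (\<Prod>(v, B)\<in>tree_nodes N. copy_pot v B (w v))"
proof -
  have "(\<Prod>(v, B)\<in>tree_nodes N. copy_pot v B (w v)) = (\<Prod>v\<in>nodes N. \<Prod>B\<in>blocks N v. copy_pot v B (w v))"
    unfolding tree_nodes_def by (rule prod.Sigma[symmetric]) (auto simp: finite_nodes finite_blocks)
  also have "\<dots> = (\<Prod>v\<in>nodes N. self_pot N v (w v))"
    by (intro prod.cong refl prod_copy_pot)
  finally show ?thesis by (simp add: gibbs_weight_def)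
qed

section \<open>Weights of the branches at a fixed copy\<close>

context
  fixes i B
  assumes iB: "i \<in> nodes N" "B \<in> blocks N i"
begin

text \<open>A link with end copies in two branches would leave the first one through its only exit,
  the root, which is in no branch.\<close>

lemma branch_links_disjoint:
  assumes "k \<in> B" "j \<in> B" "k \<noteq> j"
  shows "branch_links k i \<inter> branch_links j i = {}"
proof (rule ccontr)
  note ki = block_link_sym[OF iB assms(1)] and ji = block_link_sym[OF iB assms(2)]
  assume "branch_links k i \<inter> branch_links j i \<noteq> {}"
  then obtain u v u' v' where uv: "{u, v} \<in> links N" "copy_at N u v \<in> subtree N k i"
      "{u', v'} = {u, v}" "copy_at N u' v' \<in> subtree N j i"
    unfolding branch_links_def by blast
  from uv(3,4) have "copy_at N u v \<in> subtree N j i \<or> copy_at N v u \<in> subtree N j i"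
    by (auto simp: doubleton_eq_iff)
  with uv(2) branch_disjoint[OF iB assms] have vj: "copy_at N v u \<in> subtree N j i" by blast
  from subtree_step[OF ki uv(1,2)] show False
  proof
    assume "copy_at N v u \<in> subtree N k i"
    with vj branch_disjoint[OF iB assms] show False by blast
  next
    assume "copy_at N u v = copy_at N k i \<and> copy_at N v u = copy_at N i k"
    with vj copy_at_eq[OF iB(2) assms(1)] root_notin_branch[OF iB assms(2)] show False by simp
  qed
qed

lemma links_cover: "links N = (\<Union>k\<in>B. branch_links k i)"
proof (intro equalityI subsetI)
  fix e assume "e \<in> links N"
  then obtain u v where uv: "e = {u, v}" "{u, v} \<in> links N" "u \<noteq> v" using links_pair by metis
  have vu: "{v, u} \<in> links N" "e = {v, u}" using uv by (auto simp: insert_commute)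
  have "copy_at N u v \<noteq> (i, B) \<or> copy_at N v u \<noteq> (i, B)" using uv(3) by (auto simp: copy_at_def)
  with branch_cover[OF iB copy_at_in_tree_nodes[OF uv(2)]]
    branch_cover[OF iB copy_at_in_tree_nodes[OF vu(1)]]
  obtain k where "k \<in> B" "copy_at N u v \<in> subtree N k i \<or> copy_at N v u \<in> subtree N k i"
    by blast
  with branch_linksI[OF \<open>e \<in> links N\<close> uv(1)] branch_linksI[OF \<open>e \<in> links N\<close> vu(2)]
  show "e \<in> (\<Union>k\<in>B. branch_links k i)" by blast
qed (auto simp: branch_links_def)

lemma tree_nodes_cover: "tree_nodes N = insert (i, B) (\<Union>k\<in>B. subtree N k i)"
proof
  show "insert (i, B) (\<Union>k\<in>B. subtree N k i) \<subseteq> tree_nodes N"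
    using subtree_nodes[OF block_link_sym[OF iB]] iB by (auto simp: tree_nodes_def)
qed (use branch_cover[OF iB] in blast)

text \<open>Used with \<open>K = B\<close> for the whole network, and with
  \<open>K = B - {j}\<close> for the part behind the root away from \<open>j\<close>.\<close>

lemma prod_branches:
  assumes "K \<subseteq> B"
  shows "(\<Prod>e\<in>(\<Union>k\<in>K. branch_links k i). edge_weight N e w) *
      (\<Prod>(v, B')\<in>insert (i, B) (\<Union>k\<in>K. subtree N k i). copy_pot v B' (w v)) =
    copy_pot i B (w i) * (\<Prod>k\<in>K. branch_weight k i w)"
proof -
  have K: "finite K" using assms finite_block[OF iB(2)] by (rule finite_subset)
  have fin: "finite (subtree N k i)" if "k \<in> K" for k
    using that assms by (intro finite_subtree block_link_sym[OF iB]) auto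
  have "(\<Prod>e\<in>(\<Union>k\<in>K. branch_links k i). edge_weight N e w) =
      (\<Prod>k\<in>K. \<Prod>e\<in>branch_links k i. edge_weight N e w)"
    using K finite_branch_links branch_links_disjoint assms by (intro prod.UNION_disjoint) blast+
  moreover have "(\<Prod>(v, B')\<in>(\<Union>k\<in>K. subtree N k i). copy_pot v B' (w v)) =
      (\<Prod>k\<in>K. \<Prod>(v, B')\<in>subtree N k i. copy_pot v B' (w v))"
    using K fin branch_disjoint[OF iB] assms by (intro prod.UNION_disjoint) blast+
  moreover have "(i, B) \<notin> (\<Union>k\<in>K. subtree N k i)"
    using root_notin_branch[OF iB] assms by blast
  moreover have "finite (\<Union>k\<in>K. subtree N k i)" using K fin by blast
  ultimately show ?thesis
    by (simp add: branch_weight_def prod.distrib)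
qed

lemma gibbs_weight_split: "gibbs_weight w = copy_pot i B (w i) * (\<Prod>k\<in>B. branch_weight k i w)"
  using prod_branches[OF subset_refl, of w]
  by (simp only: gibbs_weight_tree links_cover[symmetric] tree_nodes_cover[symmetric])

text \<open>A link with an end copy at the root leads to some member \<open>v\<close> of
  \<open>B\<close> and is counted in the branch at \<open>v\<close>, unless
  \<open>v = j\<close>.\<close>

lemma branch_links_split:
  assumes "j \<in> B"
  shows "branch_links i j = insert {i, j} (\<Union>k\<in>B - {j}. branch_links k i)"
    and "{i, j} \<notin> (\<Union>k\<in>B - {j}. branch_links k i)"
proof -
  have ij: "{i, j} \<in> links N" using block_link[OF iB(2) assms] .
  have cij: "copy_at N i j = (i, B)" by (rule copy_at_eq[OF iB(2) assms])
  show "branch_links i j = insert {i, j} (\<Union>k\<in>B - {j}. branch_links k i)"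
  proof (intro equalityI subsetI)
    fix e assume "e \<in> branch_links i j"
    then obtain u v where uv: "e = {u, v}" "{u, v} \<in> links N" "copy_at N u v \<in> subtree N i j"
      by (auto simp: branch_links_def)
    show "e \<in> insert {i, j} (\<Union>k\<in>B - {j}. branch_links k i)"
    proof (cases "copy_at N u v = (i, B)")
      case True
      hence "u = i" by (metis fst_conv fst_copy_at)
      moreover from uv(2) have "v \<in> B"
        by (rule copy_at_block) (use True \<open>u = i\<close> in auto)
      moreover have "e = {v, i}" using uv(1) \<open>u = i\<close> by (simp add: insert_commute)
      hence "e \<in> branch_links v i"
        using uv(1,2) by (intro branch_linksI[OF _ \<open>e = {v, i}\<close> subtree_self]) simp
      ultimately show ?thesis using uv(1) \<open>u = i\<close> by (cases "v = j") auto
    next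
      case False
      with uv show ?thesis using subtree_split[OF iB assms] by (auto simp: branch_links_def)
    qed
  next
    fix e assume "e \<in> insert {i, j} (\<Union>k\<in>B - {j}. branch_links k i)"
    thus "e \<in> branch_links i j"
      using ij subtree_self[of i j] subtree_split[OF iB assms] by (auto simp: branch_links_def)
  qed
  show "{i, j} \<notin> (\<Union>k\<in>B - {j}. branch_links k i)"
  proof
    assume "{i, j} \<in> (\<Union>k\<in>B - {j}. branch_links k i)"
    then obtain k where k: "k \<in> B" "k \<noteq> j" "{i, j} \<in> branch_links k i" by blast
    hence "copy_at N i j \<in> subtree N k i \<or> copy_at N j i \<in> subtree N k i"
      by (auto simp: branch_links_def doubleton_eq_iff)
    with cij root_notin_branch[OF iB k(1)] subtree_self[of j i] branch_disjoint[OF iB k(1) assms k(2)]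
    show False by auto
  qed
qed

lemma branch_weight_split:
  assumes "j \<in> B"
  shows "branch_weight i j w =
    edge_pot N i j (w i) (w j) * (copy_pot i B (w i) * (\<Prod>k\<in>B - {j}. branch_weight k i w))"
proof -
  let ?F = "\<Union>k\<in>B - {j}. branch_links k i"
  have "finite ?F" by (rule finite_subset[OF _ finite_links]) (auto simp: branch_links_def)
  thus ?thesis
    using prod_branches[of "B - {j}" w] branch_links_split(2)[OF assms]
    by (simp add: branch_weight_def[of i j] branch_links_split(1)[OF assms] subtree_split[OF iB assms]
        edge_weight_eq[OF block_link[OF iB(2) assms]] mult.assoc)
qed

lemma free_nodes_split:
  "j \<in> B \<Longrightarrow> free_nodes i j = ({i} - cutset N) \<union> (\<Union>k\<in>B - {j}. free_nodes k i)"
  using subtree_split[OF iB, of j] by (auto simp: free_nodes_def)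

lemma free_nodes_cover: "nodes N - cutset N - {i} = (\<Union>k\<in>B. free_nodes k i)"
proof (intro equalityI subsetI)
  fix v assume v: "v \<in> nodes N - cutset N - {i}"
  hence "(v, nbrs N v) \<in> tree_nodes N" by (simp add: tree_nodes_def blocks_def)
  with branch_cover[OF iB] v show "v \<in> (\<Union>k\<in>B. free_nodes k i)"
    by (force simp: free_nodes_def)
next
  fix v assume "v \<in> (\<Union>k\<in>B. free_nodes k i)"
  then obtain k where k: "k \<in> B" "v \<in> free_nodes k i" by blast
  note link = block_link_sym[OF iB k(1)]
  from free_nodesD[OF link k(2)] receiver_not_free[OF link] k(2)
  show "v \<in> nodes N - cutset N - {i}" by auto
qed

text \<open>Distinct branch weights share only the value at the root and values of cutset nodes, and
  none of these is summed here.\<close>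

lemma marg_prod_branch_weight:
  assumes "K \<subseteq> B"
  shows "marg (\<Union>k\<in>K. free_nodes k i) (\<lambda>w. \<Prod>k\<in>K. branch_weight k i w) x =
    (\<Prod>k\<in>K. marg (free_nodes k i) (branch_weight k i) x)"
proof (rule marg_prod)
  have link: "{k, i} \<in> links N" if "k \<in> K" for k using that assms block_link_sym[OF iB] by blast
  show "finite K" using assms finite_block[OF iB(2)] by (rule finite_subset)
  show "finite (free_nodes k i)" if "k \<in> K" for k by (rule finite_free_nodes[OF link[OF that]])
  show "depends_on (branch_weight k i) (insert i (fst ` subtree N k i))" if "k \<in> K" for k
    by (rule branch_weight_depends_on[OF link[OF that]])
  fix k k' assume k: "k \<in> K" "k' \<in> K" "k \<noteq> k'"
  have "subtree N k i \<inter> subtree N k' i = {}" by (rule branch_disjoint[OF iB]) (use k assms in auto)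
  with link k have *: "fst ` subtree N k i \<inter> free_nodes k' i = {}" by (intro free_nodes_disjoint) auto
  thus "free_nodes k i \<inter> free_nodes k' i = {}" by (auto simp: free_nodes_def)
  from * receiver_not_free[OF link[OF k(2)]]
  show "insert i (fst ` subtree N k i) \<inter> free_nodes k' i = {}" by auto
qed

end

text \<open>
  At a cutset node \<open>j\<close> this only describes the component \<open>x j\<close> of the message: the other links in
  the branch see \<open>j\<close> through copies clamped to that value.
\<close>

lemma cond_msg_eq_marg:
  assumes "{i, j} \<in> links N"
  shows "cond_msg N x i j (x j) = marg (free_nodes i j) (branch_weight i j) x"
  using assms
proof (induction "card (subtree N i j)" arbitrary: i j x rule: less_induct)
  case (less i j x)
  obtain B where B: "B \<in> blocks N i" "j \<in> B" using less.prems by (rule copy_at_block)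
  have iB: "i \<in> nodes N" "B \<in> blocks N i" using less.prems link_nodes B by blast+
  have ij: "i \<noteq> j" using less.prems link_nodes by blast
  let ?U = "\<Union>k\<in>B - {j}. free_nodes k i"
  have link: "{k, i} \<in> links N" if "k \<in> B" for k using block_link_sym[OF iB that] .
  have iU: "i \<notin> ?U" using receiver_not_free link by blast
  have jU: "j \<notin> ?U" using receiver_not_free[OF less.prems] free_nodes_split[OF iB B(2)] by blast
  have IH: "marg (free_nodes k i) (branch_weight k i) y = cond_msg N y k i (y i)"
    if "k \<in> B - {j}" for k y
    using that card_subtree_less[OF less.prems B] link by (intro less.hyps[symmetric]) auto
  have "marg ?U (branch_weight i j) y =
      edge_pot N i j (y i) (y j) * copy_pot i B (y i) * marg ?U (\<lambda>w. \<Prod>k\<in>B - {j}. branch_weight k i w) y"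
    for y
    unfolding branch_weight_split[OF iB B(2)] mult.assoc[symmetric]
    by (rule marg_mult_left[where S = "{i, j}"]) (use iU jU in \<open>auto simp: depends_on_def\<close>)
  hence U: "marg ?U (branch_weight i j) y =
      edge_pot N i j (y i) (y j) * copy_pot i B (y i) * (\<Prod>k\<in>B - {j}. cond_msg N y k i (y i))" for y
    by (simp add: marg_prod_branch_weight[OF iB] IH)
  show ?case
  proof (cases "i \<in> cutset N")
    case True
    hence "marg (free_nodes i j) (branch_weight i j) x = marg ?U (branch_weight i j) x"
      by (simp add: free_nodes_split[OF iB B(2)])
    \<comment> \<open>The value at a cutset node \<open>i\<close> is not summed; the indicator
      reproduces the clamp that leaves one term of the matrix product.\<close>
    also have "\<dots> = (\<Sum>a\<in>UNIV. if a = x i then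
        edge_pot N i j a (x j) * copy_pot i B a * (\<Prod>k\<in>B - {j}. cond_msg N x k i a) else 0)"
      by (simp add: U)
    also have "\<dots> = cond_msg N x i j (x j)"
      unfolding cond_msg_rec[OF B] edge_act_def
      by (intro sum.cong) (auto simp: node_pot_def True)
    finally show ?thesis ..
  next
    case False
    hence "marg (free_nodes i j) (branch_weight i j) x =
        (\<Sum>a\<in>UNIV. marg ?U (branch_weight i j) (x(i := a)))"
      by (simp add: free_nodes_split[OF iB B(2)] insert_Diff_if marg_insert[OF iU])
    also have "\<dots> = cond_msg N x i j (x j)"
      unfolding cond_msg_rec[OF B] edge_act_def
    proof (intro sum.cong refl)
      fix a
      \<comment> \<open>Conditioned messages depend on cutset values only, and \<open>i\<close> is
        outside the cutset.\<close>
      have "cond_msg N (x(i := a)) k i a = cond_msg N x k i a" if "k \<in> B" for k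
        by (rule depends_onD[OF cond_msg_depends_on[OF link[OF that]]])
          (use False in \<open>auto simp: touched_def\<close>)
      thus "marg ?U (branch_weight i j) (x(i := a)) =
          edge_pot N i j a (x j) * (node_pot i B x a * (\<Prod>k\<in>B - {j}. cond_msg N x k i a))"
        using ij by (simp add: U node_pot_def False)
    qed
    finally show ?thesis ..
  qed
qed

subsection \<open>Beliefs\<close>

lemma gibbs_weight_cong:
  assumes "\<And>v. v \<in> nodes N \<Longrightarrow> x v = y v"
  shows "gibbs_weight x = gibbs_weight y"
proof -
  have "edge_weight N e x = edge_weight N e y" if e: "e \<in> links N" for e
  proof -
    obtain u v where "u \<in> nodes N" "v \<in> nodes N" "e = {u, v}" using links_pair[OF e] by blast
    with assms e show ?thesis by (simp add: edge_weight_eq)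
  qed
  with assms show ?thesis by (simp add: gibbs_weight_def)
qed

lemma gibbs_weight_node:
  assumes "i \<in> nodes N"
  shows "self_pot N i a *
      ((\<Prod>e\<in>links N. edge_weight N e (z(i := a))) * (\<Prod>j\<in>nodes N - {i}. self_pot N j (z j))) =
    gibbs_weight (z(i := a))"
  by (simp add: gibbs_weight_def prod.remove[OF finite_nodes assms])

text \<open>Configurations that agree with \<open>x\<close> on \<open>S\<close> correspond to their
  values off \<open>S\<close> and \<open>i\<close>. If \<open>i\<close> is in \<open>S\<close> and
  \<open>a\<close> differs from \<open>x i\<close>, none contributes;
  \<open>cond_belief_clamped\<close> treats that case.\<close>

lemma cond_belief_eq_marg:
  assumes "i \<in> nodes N" "S \<subseteq> nodes N" "i \<in> S \<Longrightarrow> a = x i"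
  shows "cond_belief N i S x a = marg (nodes N - insert i S) gibbs_weight (x(i := a))"
proof -
  let ?D = "nodes N - insert i S" and ?V = "nodes N - {i}"
  have "cond_belief N i S x a =
      (\<Sum>z\<in>{z \<in> configs ?V. \<forall>s\<in>S. (z(i := a)) s = x s}. gibbs_weight (z(i := a)))"
    unfolding cond_belief_def sum_distrib_left gibbs_weight_node[OF assms(1)] ..
  also have "\<dots> = marg ?D gibbs_weight (x(i := a))"
    unfolding marg_def
  proof (rule sum.reindex_bij_witness[of _ "\<lambda>u. restrict (override_on x u ?D) ?V" "\<lambda>z. restrict z ?D"])
    fix z assume z: "z \<in> {z \<in> configs ?V. \<forall>s\<in>S. (z(i := a)) s = x s}"
    have "z v = undefined" if "v \<notin> ?V" for v
      using z that unfolding configs_def by (blast intro: PiE_arb)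
    moreover have "x v = z v" if "v \<in> S" "v \<noteq> i" for v using z that by auto
    ultimately show "restrict (override_on x (restrict z ?D) ?D) ?V = z"
      by (auto simp: fun_eq_iff override_on_def)
    show "restrict z ?D \<in> configs ?D" by (simp add: configs_def)
    show "gibbs_weight (override_on (x(i := a)) (restrict z ?D) ?D) = gibbs_weight (z(i := a))"
      by (rule gibbs_weight_cong) (use z in \<open>auto simp: override_on_def\<close>)
  next
    fix u :: "'v \<Rightarrow> 'x" assume u: "u \<in> configs ?D"
    have "u v = undefined" if "v \<notin> ?D" for v
      using u that unfolding configs_def by (blast intro: PiE_arb)
    thus "restrict (restrict (override_on x u ?D) ?V) ?D = u"
      by (auto simp: fun_eq_iff override_on_def)
    show "restrict (override_on x u ?D) ?V \<in> {z \<in> configs ?V. \<forall>s\<in>S. (z(i := a)) s = x s}"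
      using assms by (auto simp: configs_def override_on_def)
  qed
  finally show ?thesis .
qed

lemma cond_belief_clamped:
  assumes "i \<in> S" "a \<noteq> x i"
  shows "cond_belief N i S x a = 0"
proof -
  have "{z \<in> configs (nodes N - {i}). \<forall>s\<in>S. (z(i := a)) s = x s} = {}" using assms by force
  thus ?thesis unfolding cond_belief_def by (simp only: sum.empty mult_zero_right)
qed

lemma finite_configs: "finite S \<Longrightarrow> finite (configs S :: ('v \<Rightarrow> 'x) set)"
  by (simp add: configs_def finite_PiE)

lemma belief_sum:
  assumes "S \<subseteq> nodes N"
  shows "belief N i a = (\<Sum>x\<in>configs S. cond_belief N i S x a)"
proof -
  let ?A = "configs (nodes N - {i}) :: ('v \<Rightarrow> 'x) set"
  let ?f = "\<lambda>z. (\<Prod>e\<in>links N. edge_weight N e (z(i := a))) * (\<Prod>j\<in>nodes N - {i}. self_pot N j (z j))"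
  \<comment> \<open>Configurations are grouped by their values on \<open>S\<close>. The value
    \<open>a\<close> is inserted first because \<open>i\<close> may belong to
    \<open>S\<close>.\<close>
  let ?g = "\<lambda>z. restrict (z(i := a)) S"
  have "(\<Sum>z\<in>?A. ?f z) = (\<Sum>x\<in>configs S. \<Sum>z\<in>{z\<in>?A. ?g z = x}. ?f z)"
  proof (rule sum.group[symmetric])
    show "finite ?A" using finite_nodes by (intro finite_configs) simp
    show "finite (configs S :: ('v \<Rightarrow> 'x) set)"
      by (rule finite_configs[OF finite_subset[OF assms finite_nodes]])
    show "?g ` ?A \<subseteq> configs S" unfolding configs_def by (rule image_subsetI) simp
  qed
  also have "\<dots> = (\<Sum>x\<in>configs S. \<Sum>z\<in>{z\<in>?A. \<forall>s\<in>S. (z(i := a)) s = x s}. ?f z)"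
  proof (rule sum.cong[OF refl])
    fix x :: "'v \<Rightarrow> 'x" assume "x \<in> configs S"
    hence "x = restrict x S" by (simp add: configs_def PiE_restrict)
    hence "?g z = x \<longleftrightarrow> ?g z = restrict x S" for z by (rule arg_cong)
    hence "?g z = x \<longleftrightarrow> (\<forall>v. restrict (z(i := a)) S v = restrict x S v)" for z
      by (simp only: fun_eq_iff)
    moreover have "(\<forall>v. restrict (z(i := a)) S v = restrict x S v) \<longleftrightarrow> (\<forall>s\<in>S. (z(i := a)) s = x s)" for z
      by (auto simp: restrict_def)
    ultimately have "?g z = x \<longleftrightarrow> (\<forall>s\<in>S. (z(i := a)) s = x s)" for z by blast
    thus "(\<Sum>z\<in>{z\<in>?A. ?g z = x}. ?f z) = (\<Sum>z\<in>{z\<in>?A. \<forall>s\<in>S. (z(i := a)) s = x s}. ?f z)"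
      by simp
  qed
  finally show ?thesis unfolding belief_def cond_belief_def by (simp add: sum_distrib_left)
qed

text \<open>The nodes that are not fixed are summed in two stages. Free nodes turn branch weights
  into conditioned messages; then the irrelevant cutset nodes, each upstream of a single branch,
  turn these into local messages.\<close>

lemma cond_belief_rel_node:
  assumes iB: "i \<in> nodes N" "B \<in> blocks N i" and split: "i \<in> cutset N \<Longrightarrow> is_split N i"
  shows "cond_belief N i (rel_node N i B) x a = node_pot i B x a * (\<Prod>k\<in>B. local_msg N k i x a)"
proof (cases "i \<in> cutset N \<and> a \<noteq> x i")
  case True
  with root_in_rel_node[OF iB split] show ?thesis by (simp add: cond_belief_clamped node_pot_def)
next
  case False
  let ?R = "rel_node N i B" and ?U = "\<Union>k\<in>B. upstream N k i" and ?y = "x(i := a)"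
  let ?F = "nodes N - cutset N - {i}"
  have link: "{k, i} \<in> links N" if "k \<in> B" for k using block_link_sym[OF iB that] .
  have U: "?U = cutset N - ?R" using cutset_minus_rel_node[OF iB split] by simp
  have iU: "i \<notin> ?U" using root_notin_upstream[OF iB] by blast
  have *: "nodes N - insert i ?R = ?U \<union> ?F"
    using rel_node_cutset cutset_nodes iU root_in_rel_node[OF iB split] unfolding U by blast
  have F: "marg ?F gibbs_weight = (\<lambda>y. copy_pot i B (y i) * (\<Prod>k\<in>B. cond_msg N y k i (y i)))"
  proof
    fix y
    have "marg ?F gibbs_weight y = copy_pot i B (y i) * marg ?F (\<lambda>w. \<Prod>k\<in>B. branch_weight k i w) y"
      unfolding gibbs_weight_split[OF iB]
      by (rule marg_mult_left[where S = "{i}"]) (auto simp: depends_on_def)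
    thus "marg ?F gibbs_weight y = copy_pot i B (y i) * (\<Prod>k\<in>B. cond_msg N y k i (y i))"
      by (simp add: free_nodes_cover[OF iB] marg_prod_branch_weight[OF iB] cond_msg_eq_marg link)
  qed
  have "?U \<inter> ?F = {}" unfolding U by blast
  hence "marg (nodes N - insert i ?R) gibbs_weight ?y =
      marg ?U (\<lambda>y. copy_pot i B (y i) * (\<Prod>k\<in>B. cond_msg N y k i (y i))) ?y"
    unfolding * by (simp only: marg_union[OF finite_UN_upstream] F)
  also have "\<dots> = marg ?U (\<lambda>y. copy_pot i B a * (\<Prod>k\<in>B. cond_msg N y k i a)) ?y"
    unfolding marg_def using iU by (simp add: override_on_def)
  also have "\<dots> = copy_pot i B a * (\<Prod>k\<in>B. local_msg N k i ?y a)"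
    by (subst marg_mult_left[where S = "{}"]) (auto simp: depends_on_def marg_prod_cond_msg[OF iB])
  \<comment> \<open>The configurations differ at most at \<open>i\<close>. If \<open>i\<close> is a
    cutset node then \<open>a = x i\<close> and they agree; otherwise local messages do not see
    \<open>i\<close>.\<close>
  also have "(\<Prod>k\<in>B. local_msg N k i ?y a) = (\<Prod>k\<in>B. local_msg N k i x a)"
  proof (rule prod.cong[OF refl])
    fix k assume "k \<in> B"
    show "local_msg N k i ?y a = local_msg N k i x a"
      by (rule depends_onD[OF local_msg_depends_on[OF link[OF \<open>k \<in> B\<close>]]])
        (use False rel_edge_cutset[of k i] in auto)
  qed
  also have "copy_pot i B a = node_pot i B x a" using False by (auto simp: node_pot_def)
  finally have "marg (nodes N - insert i ?R) gibbs_weight ?y =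
      node_pot i B x a * (\<Prod>k\<in>B. local_msg N k i x a)" .
  moreover have "cond_belief N i ?R x a = marg (nodes N - insert i ?R) gibbs_weight ?y"
    by (rule cond_belief_eq_marg)
      (use iB False rel_node_cutset[of i B] rel_edge_cutset cutset_nodes in auto)
  ultimately show ?thesis by simp
qed

lemma belief_sum_rel_node: "belief N i = (\<lambda>a. \<Sum>x\<in>configs (rel_node N i S). cond_belief N i (rel_node N i S) x a)"
  using belief_sum rel_node_cutset cutset_nodes by (blast intro: ext)

text \<open>The only block of a free node is its whole neighbourhood, and its potential does not
  depend on the configuration, so it leaves the sum.\<close>

lemma free_node_rules:
  assumes j: "j \<in> nodes N - cutset N"
  shows "cond_belief N j (rel_node N j (nbrs N j)) x =
      (\<lambda>a. self_pot N j a * (\<Prod>k\<in>nbrs N j. local_msg N k j (restrict x (rel_edge N k j)) a))"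
    and "i \<in> nbrs N j \<Longrightarrow>
      sum_set N (nbrs N j) j i = upstream N j i - (\<Union>k\<in>nbrs N j - {i}. upstream N k j)"
    and "i \<in> nbrs N j \<Longrightarrow> local_msg N j i x =
      edge_act N j i (\<lambda>a. self_pot N j a *
        (\<Sum>y\<in>configs (sum_set N (nbrs N j) j i). \<Prod>k\<in>nbrs N j - {i}.
          local_msg N k j (restrict (override_on x y (sum_set N (nbrs N j) j i)) (rel_edge N j k)) a))"
proof -
  have iB: "j \<in> nodes N" "nbrs N j \<in> blocks N j" using j by (auto simp: blocks_def)
  have split: "j \<in> cutset N \<Longrightarrow> is_split N j" using j by blast
  have restr: "local_msg N k j (restrict w (rel_edge N k j)) a = local_msg N k j w a"
    if "k \<in> nbrs N j" for k w a
    by (rule local_msg_restrict[OF block_link_sym[OF iB that]])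
  have "cond_belief N j (rel_node N j (nbrs N j)) x a =
      node_pot j (nbrs N j) x a * (\<Prod>k\<in>nbrs N j. local_msg N k j x a)" for a
    by (rule cond_belief_rel_node[OF iB split])
  thus "cond_belief N j (rel_node N j (nbrs N j)) x =
      (\<lambda>a. self_pot N j a * (\<Prod>k\<in>nbrs N j. local_msg N k j (restrict x (rel_edge N k j)) a))"
    using j by (simp add: fun_eq_iff node_pot_free restr)
  assume i: "i \<in> nbrs N j"
  show "sum_set N (nbrs N j) j i = upstream N j i - (\<Union>k\<in>nbrs N j - {i}. upstream N k j)"
    by (rule sum_set_eq[OF iB split i])
  have "local_msg N j i x = edge_act N j i (\<lambda>a. \<Sum>y\<in>configs (sum_set N (nbrs N j) j i).
    node_pot j (nbrs N j) (override_on x y (sum_set N (nbrs N j) j i)) a *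
    (\<Prod>k\<in>nbrs N j - {i}. local_msg N k j (override_on x y (sum_set N (nbrs N j) j i)) a))"
    by (rule local_msg_rec[OF iB split i])
  thus "local_msg N j i x =
      edge_act N j i (\<lambda>a. self_pot N j a *
        (\<Sum>y\<in>configs (sum_set N (nbrs N j) j i). \<Prod>k\<in>nbrs N j - {i}.
          local_msg N k j (restrict (override_on x y (sum_set N (nbrs N j) j i)) (rel_edge N j k)) a))"
    using j by (simp add: node_pot_free sum_distrib_left rel_edge_commute[of j] restr)
qed

text \<open>Stated for an arbitrary block, so that leaf copies and the non-leaf copy are both
  instances.\<close>

lemma split_node_rules:
  assumes l: "l \<in> cutset N" "is_split N l" and B: "B \<in> ident N l"
  shows "cond_belief N l (rel_node N l B) x =
      (\<lambda>a. clamped_pot N l B (x l) a * (\<Prod>k\<in>B. local_msg N k l (restrict x (rel_edge N k l)) a))"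
    and "i \<in> B \<Longrightarrow> sum_set N B l i = upstream N l i - (\<Union>k\<in>B - {i}. upstream N k l)"
    and "i \<in> B \<Longrightarrow> local_msg N l i x =
      edge_act N l i (\<lambda>a. \<Sum>y\<in>configs (sum_set N B l i).
        clamped_pot N l B (override_on x y (sum_set N B l i) l) a *
        (\<Prod>k\<in>B - {i}. local_msg N k l (restrict (override_on x y (sum_set N B l i)) (rel_edge N k l)) a))"
proof -
  have iB: "l \<in> nodes N" "B \<in> blocks N l" using l(1) B cutset_nodes by (auto simp: blocks_def)
  have restr: "local_msg N k l (restrict w (rel_edge N k l)) a = local_msg N k l w a"
    if "k \<in> B" for k w a
    by (rule local_msg_restrict[OF block_link_sym[OF iB that]])
  show "cond_belief N l (rel_node N l B) x =
      (\<lambda>a. clamped_pot N l B (x l) a * (\<Prod>k\<in>B. local_msg N k l (restrict x (rel_edge N k l)) a))"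
    using l by (simp add: fun_eq_iff cond_belief_rel_node[OF iB] node_pot_cutset restr)
  assume i: "i \<in> B"
  show "sum_set N B l i = upstream N l i - (\<Union>k\<in>B - {i}. upstream N k l)"
    by (rule sum_set_eq[OF iB l(2) i])
  show "local_msg N l i x =
      edge_act N l i (\<lambda>a. \<Sum>y\<in>configs (sum_set N B l i).
        clamped_pot N l B (override_on x y (sum_set N B l i) l) a *
        (\<Prod>k\<in>B - {i}. local_msg N k l (restrict (override_on x y (sum_set N B l i)) (rel_edge N k l)) a))"
    using l by (simp add: local_msg_rec[OF iB l(2) i] node_pot_cutset restr)
qed

end

theorem theorem1:
  fixes N :: "('v, 'x::finite) cut_network"
  assumes "gibbs_network N"
    and "loop_cutset N"
    and "associated_tree N"
    and "potential_splitting N"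
  shows
    "(\<forall>j \<in> nodes N - cutset N.
       (\<forall>x \<in> configs (rel_node N j (nbrs N j)).
          cond_belief N j (rel_node N j (nbrs N j)) x =
            (\<lambda>a. self_pot N j a *
               (\<Prod>k\<in>nbrs N j. local_msg N k j (restrict x (rel_edge N k j)) a)))
     \<and> (\<forall>i \<in> nbrs N j.
          sum_set N (nbrs N j) j i = upstream N j i - (\<Union>k\<in>nbrs N j - {i}. upstream N k j)
        \<and> (\<forall>x \<in> configs (rel_edge N j i).
             local_msg N j i x =
               edge_act N j i (\<lambda>a. self_pot N j a *
                 (\<Sum>y\<in>configs (sum_set N (nbrs N j) j i).
                    \<Prod>k\<in>nbrs N j - {i}.
                      local_msg N k j
                        (restrict (override_on x y (sum_set N (nbrs N j) j i)) (rel_edge N j k)) a))))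
     \<and> belief N j =
          (\<lambda>a. \<Sum>x\<in>configs (rel_node N j (nbrs N j)). cond_belief N j (rel_node N j (nbrs N j)) x a))
   \<and>
   (\<forall>l \<in> cutset N.
       (is_split N l \<longrightarrow>
          leaf_nbrs N l \<noteq> {}
        \<and> (\<forall>j \<in> leaf_nbrs N l. \<forall>x \<in> configs (rel_node N l {j}).
             cond_belief N l (rel_node N l {j}) x =
               (\<lambda>a. clamped_pot N l {j} (x l) a * local_msg N j l (restrict x (rel_edge N j l)) a))
        \<and> (inner_nbrs N l \<noteq> {} \<longrightarrow>
             (\<forall>S \<in> {inner_nbrs N l, nbrs N l}. \<forall>x \<in> configs (rel_node N l S).
                cond_belief N l (rel_node N l S) x =
                  (\<lambda>a. clamped_pot N l (inner_nbrs N l) (x l) a *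
                     (\<Prod>j\<in>inner_nbrs N l. local_msg N j l (restrict x (rel_edge N j l)) a))))
        \<and> (\<forall>i \<in> inner_nbrs N l.
             sum_set N (inner_nbrs N l) l i =
               upstream N l i - (\<Union>k\<in>inner_nbrs N l - {i}. upstream N k l)
           \<and> (\<forall>S \<in> {inner_nbrs N l, nbrs N l}. \<forall>x \<in> configs (rel_edge N l i).
                local_msg N l i x =
                  edge_act N l i (\<lambda>a.
                    \<Sum>y\<in>configs (sum_set N S l i).
                      clamped_pot N l (inner_nbrs N l) (override_on x y (sum_set N S l i) l) a *
                      (\<Prod>k\<in>inner_nbrs N l - {i}.
                         local_msg N k l
                           (restrict (override_on x y (sum_set N S l i)) (rel_edge N k l)) a)))))
     \<and> (\<forall>S \<in> {inner_nbrs N l, nbrs N l} \<union> {{j} | j. j \<in> leaf_nbrs N l}.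
          belief N l = (\<lambda>a. \<Sum>x\<in>configs (rel_node N l S). cond_belief N l (rel_node N l S) x a)))"
proof -
  interpret opened_network N
    using assms by unfold_locales (auto simp: loop_cutset_def)
  show ?thesis
  proof (intro conjI ballI impI)
    fix j x assume j: "j \<in> nodes N - cutset N"
    show "cond_belief N j (rel_node N j (nbrs N j)) x =
        (\<lambda>a. self_pot N j a * (\<Prod>k\<in>nbrs N j. local_msg N k j (restrict x (rel_edge N k j)) a))"
      by (rule free_node_rules(1)[OF j])
    fix i assume i: "i \<in> nbrs N j"
    show "sum_set N (nbrs N j) j i = upstream N j i - (\<Union>k\<in>nbrs N j - {i}. upstream N k j)"
      by (rule free_node_rules(2)[OF j i])
    show "local_msg N j i x =
        edge_act N j i (\<lambda>a. self_pot N j a *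
          (\<Sum>y\<in>configs (sum_set N (nbrs N j) j i). \<Prod>k\<in>nbrs N j - {i}.
            local_msg N k j (restrict (override_on x y (sum_set N (nbrs N j) j i)) (rel_edge N j k)) a))"
      by (rule free_node_rules(3)[OF j i])
  next
    fix l x j assume l: "l \<in> cutset N" "is_split N l" and j: "j \<in> leaf_nbrs N l"
    show "cond_belief N l (rel_node N l {j}) x =
        (\<lambda>a. clamped_pot N l {j} (x l) a * local_msg N j l (restrict x (rel_edge N j l)) a)"
      using split_node_rules(1)[OF l leaf_ident[OF l(1) j]] by simp
  next
    fix l S x assume l: "l \<in> cutset N" "is_split N l" and ne: "inner_nbrs N l \<noteq> {}"
      and S: "S \<in> {inner_nbrs N l, nbrs N l}"
    from S have "rel_node N l S = rel_node N l (inner_nbrs N l)"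
      using rel_node_nbrs[OF l ne] by blast
    thus "cond_belief N l (rel_node N l S) x =
        (\<lambda>a. clamped_pot N l (inner_nbrs N l) (x l) a *
          (\<Prod>j\<in>inner_nbrs N l. local_msg N j l (restrict x (rel_edge N j l)) a))"
      using split_node_rules(1)[OF l inner_ident[OF l(1) ne]] by (simp only:)
  next
    fix l i assume l: "l \<in> cutset N" "is_split N l" and i: "i \<in> inner_nbrs N l"
    hence ne: "inner_nbrs N l \<noteq> {}" by blast
    note rules = split_node_rules(2,3)[OF l inner_ident[OF l(1) ne] i]
    show "sum_set N (inner_nbrs N l) l i =
        upstream N l i - (\<Union>k\<in>inner_nbrs N l - {i}. upstream N k l)"
      by (rule rules(1))
    fix S x assume "S \<in> {inner_nbrs N l, nbrs N l}"
    hence "sum_set N S l i = sum_set N (inner_nbrs N l) l i"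
      using sum_set_nbrs[OF l ne i] by blast
    thus "local_msg N l i x =
        edge_act N l i (\<lambda>a. \<Sum>y\<in>configs (sum_set N S l i).
          clamped_pot N l (inner_nbrs N l) (override_on x y (sum_set N S l i) l) a *
          (\<Prod>k\<in>inner_nbrs N l - {i}.
            local_msg N k l (restrict (override_on x y (sum_set N S l i)) (rel_edge N k l)) a))"
      using rules(2) by (simp only:)
  \<comment> \<open>What remains is the existence of a leaf neighbour and the formulas for
    unconditioned beliefs.\<close>
  qed (simp_all only: split_leaf belief_sum_rel_node[symmetric] not_False_eq_True)
qed

end
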